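(* Let $n\ge 1$, $0<\alpha<2$ and $0<p<\infty$. There is a constant $C(\alpha,p,n)>0$, depending only on $\alpha,p,n$, such that for every function $f:\mathbb{R}^n\to\mathbb{R}$ in the Schwartz class and every $x\in\mathbb{R}^n$, $$|f(x)|^{2+\frac{\alpha p}{n}}\leq C(\alpha,p,n)\,\|f\|_{L^p(\mathbb{R}^n)}^{\frac{\alpha p}{n}}\,\bigl(2f(x)\Lambda^\alpha f(x)-\Lambda^\alpha(f^2)(x)\bigr).$$
   Context: $\Lambda^\alpha=(-\Delta)^{\alpha/2}$ on $\mathbb{R}^n$, given by $\Lambda^\alpha f(x)=k_{\alpha,n}\,\mathrm{P.V.}\int_{\mathbb{R}^n}\frac{f(x)-f(y)}{|x-y|^{n+\alpha}}\,dy$, where $k_{\alpha,n}>0$ is the normalizing constant making this the Fourier multiplier $|\xi|^\alpha$. For $0<p<1$, $\|f\|_{L^p(\mathbb{R}^n)}$ denotes $\left(\int_{\mathbb{R}^n}|f|^p\,dx\right)^{1/p}$ as well. *)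

theory Defs
  imports "HOL-Analysis.Analysis"
begin

primrec partials :: "'n list \<Rightarrow> (real^'n \<Rightarrow> real) \<Rightarrow> real^'n \<Rightarrow> real" where
  "partials [] f = f"
| "partials (i # is) f = (\<lambda>x. frechet_derivative (partials is f) (at x) (axis i 1))"

text \<open>The first conjunct says that \<open>f\<close> is smooth: once every iterated partial derivative is
  differentiable, all of them are continuous.\<close>

definition schwartz :: "(real^'n \<Rightarrow> real) \<Rightarrow> bool" where
  "schwartz f \<longleftrightarrow>
     (\<forall>is. partials is f differentiable_on UNIV) \<and>
     (\<forall>is m. bounded (range (\<lambda>x. norm x ^ m * partials is f x)))"

definition Lp_norm :: "real \<Rightarrow> (real^'n \<Rightarrow> real) \<Rightarrow> real" where
  "Lp_norm p f = (LINT x|lborel. \<bar>f x\<bar> powr p) powr (1 / p)"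

definition fourier :: "(real^'n \<Rightarrow> real) \<Rightarrow> real^'n \<Rightarrow> complex" where
  "fourier f \<xi> = (LINT x|lborel. cis (- (\<xi> \<bullet> x)) * complex_of_real (f x))"

definition pv_integral :: "real \<Rightarrow> (real^'n \<Rightarrow> real) \<Rightarrow> real^'n \<Rightarrow> real" where
  "pv_integral \<alpha> f x =
     Lim (at_right 0) (\<lambda>\<epsilon>. LINT y:- cball x \<epsilon>|lborel.
       (f x - f y) / norm (x - y) powr (real CARD('n) + \<alpha>))"

text \<open>The constant depends on the dimension \<open>CARD('n)\<close>, which enters only through a type;
  the dummy argument \<open>TYPE('n)\<close> makes that dependence explicit. The angular-frequency convention
  in \<^const>\<open>fourier\<close> is the one for which \<open>(-\<Delta>)\<^bsup>\<alpha>/2\<^esup>\<close> has symbol \<open>|\<xi>|\<^bsup>\<alpha>\<^esup>\<close>.\<close>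

definition frac_const :: "real \<Rightarrow> 'n::finite itself \<Rightarrow> real" where
  "frac_const \<alpha> _ = (THE k. 0 < k \<and>
     (\<forall>(f :: real^'n \<Rightarrow> real) \<xi>. schwartz f \<longrightarrow>
        fourier (\<lambda>x. k * pv_integral \<alpha> f x) \<xi> = complex_of_real (norm \<xi> powr \<alpha>) * fourier f \<xi>))"

definition frac_laplacian :: "real \<Rightarrow> (real^'n \<Rightarrow> real) \<Rightarrow> real^'n \<Rightarrow> real" where
  "frac_laplacian \<alpha> f x = frac_const \<alpha> TYPE('n) * pv_integral \<alpha> f x"

end

theory Submission
  imports Defs
begin

text \<open>Write \<open>n\<close> for the dimension. Two facts combine.

\<^item> The carre du champ identity. Since
\<open>2 f(x) (f(x) - f(y)) - (f(x)\<^sup>2 - f(y)\<^sup>2) = (f(x) - f(y))\<^sup>2\<close>, the difference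
\<open>2 f \<Lambda>\<^sup>\<alpha> f - \<Lambda>\<^sup>\<alpha> (f\<^sup>2)\<close> at \<open>x\<close> is the normalizing constant times
\<open>D = \<integral> (f(x) - f(x + h))\<^sup>2 |h| powr -(n + \<alpha>) dh\<close> (lemma \<open>carre_du_champ\<close>). The singularity
is now integrable and the integrand is nonnegative.

\<^item> A lower bound for \<open>D\<close>. Put \<open>A = |f(x)|\<close>. By Chebyshev's inequality the set where
\<open>|f(x + h)| \<ge> A/2\<close> has measure at most \<open>M = \<integral> |f| powr p / (A/2) powr p\<close>. A ball of volume
\<open>2 M\<close> therefore contains a set of measure at least \<open>M\<close> on which \<open>|f(x) - f(x + h)| \<ge> A/2\<close>, and there
the kernel is at least \<open>R powr -(n + \<alpha>)\<close>, where \<open>R\<close> is the radius of the ball. Hence \<open>D\<close> is at least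
a constant times \<open>M A\<^sup>2 R powr -(n + \<alpha>)\<close>, that is, a constant times \<open>A\<^sup>2 M powr -(\<alpha>/n)\<close>, because
\<open>R powr n\<close> is proportional to \<open>M\<close>. This is the claim (lemma \<open>jump_energy_lower_bound\<close>).

The rest of the work shows that the normalizing constant, which is described only as the unique \<open>k > 0\<close>
for which \<open>k\<close> times the principal value integral has symbol \<open>|\<xi>| powr \<alpha>\<close>, exists and is unique; a
definite description without a unique witness would say nothing about the sign of \<open>k\<close>. The principal
value integral is half the absolutely convergent integral of the second difference
\<open>2 f(x) - f(x + h) - f(x - h)\<close> against the kernel, so Fubini's theorem gives its Fourier transform as
\<open>symbol \<alpha> \<xi> = \<integral> (1 - cos (\<xi> \<bullet> y)) |y| powr -(n + \<alpha>) dy\<close> times that of \<open>f\<close>. This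
symbol is invariant under rotations and homogeneous of degree \<open>\<alpha>\<close>, hence \<open>c |\<xi>| powr \<alpha>\<close> with
\<open>c > 0\<close>, and \<open>k = 1/c\<close> has the required property. It is the only such constant because some Schwartz function,
the Gaussian, has a Fourier transform that does not vanish at some nonzero frequency
(lemma \<open>frac_const_eq\<close>).\<close>

section \<open>Lebesgue measure under translations, dilations and rotations\<close>

lemma distr_lborel_translation:
  fixes t :: "'a::euclidean_space"
  shows "distr lborel borel (\<lambda>x. t + x) = lborel"
  using lborel_affine[of 1 t] by (simp add: density_1)

lemma distr_lborel_uminus:
  "distr lborel borel (\<lambda>x::'a::euclidean_space. - x) = lborel"
  using lborel_affine[of "-1" "0::'a"] by (simp add: density_1)

lemma
  fixes f :: "'a::euclidean_space \<Rightarrow> 'b::{banach, second_countable_topology}"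
  assumes "distr lborel borel T = lborel" "T \<in> borel_measurable borel"
    and "f \<in> borel_measurable borel"
  shows integral_lborel_invariant: "(LINT x|lborel. f (T x)) = integral\<^sup>L lborel f"
    and integrable_lborel_invariant: "integrable lborel (\<lambda>x. f (T x)) \<longleftrightarrow> integrable lborel f"
  using integral_distr[of T lborel borel f] integrable_distr_eq[of T lborel borel f] assms
  by simp_all

lemma integral_lborel_scale:
  fixes f :: "'a::euclidean_space \<Rightarrow> real"
  assumes "0 < c" and [measurable]: "f \<in> borel_measurable borel"
  shows "(LINT x|lborel. f (c *\<^sub>R x)) = integral\<^sup>L lborel f / c ^ DIM('a)"
proof -
  have "integral\<^sup>L lborel f = integral\<^sup>L (density (distr lborel borel (\<lambda>x. 0 + c *\<^sub>R x)) (\<lambda>_. \<bar>c\<bar>^DIM('a))) f"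
    using lborel_affine[of c "0::'a"] assms by simp
  also have "\<dots> = c ^ DIM('a) * (LINT x|lborel. f (c *\<^sub>R x))"
    using assms by (simp add: integral_density integral_distr)
  finally show ?thesis using assms by simp
qed

text \<open>Uniqueness of Haar measure on \<open>\<real>\<^sup>n\<close>, by Fubini's theorem: in the \<open>M \<otimes> lborel\<close>-measure of
\<open>A \<times> B\<close> shift the second variable by the first, and then the first by minus the second.
Together with the invariance of \<open>lborel\<close> under reflection this exchanges the roles of the two
factors, so that the products \<open>M A * lborel B\<close> and
\<open>lborel A * M B\<close> agree; \<open>B\<close> is the unit ball, where both measures coincide and are
positive and finite.\<close>

lemma lborel_eq_of_translation_invariant:
  fixes M :: "'a::euclidean_space measure"
  assumes sets: "sets M = sets borel" and fin: "sigma_finite_measure M"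
    and inv: "\<And>t. distr M borel (\<lambda>x. t + x) = M"
    and ball: "emeasure M (cball 0 1) = emeasure lborel (cball (0::'a) 1)"
  shows "M = lborel"
proof (rule measure_eqI)
  show "sets M = sets lborel" using sets by simp
  fix A assume "A \<in> sets M"
  then have [measurable]: "A \<in> sets borel" using sets by simp
  interpret M: sigma_finite_measure M by fact
  interpret P: pair_sigma_finite M lborel
    by (intro pair_sigma_finite.intro fin sigma_finite_lborel)
  have [measurable_cong]: "sets M = sets borel" by fact
  let ?B = "cball (0::'a) 1"
  have [measurable]: "?B \<in> sets borel" by simp
  have shiftM: "(\<integral>\<^sup>+x. h (t + x) \<partial>M) = (\<integral>\<^sup>+x. h x \<partial>M)"
    if "h \<in> borel_measurable borel" for h :: "'a \<Rightarrow> ennreal" and t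
    using nn_integral_distr[of "\<lambda>x. t + x" M borel h] that inv[of t] by simp
  have shiftL: "(\<integral>\<^sup>+x. h (t + x) \<partial>lborel) = (\<integral>\<^sup>+x. h x \<partial>lborel)"
    if "h \<in> borel_measurable borel" for h :: "'a \<Rightarrow> ennreal" and t
    using nn_integral_distr[of "\<lambda>x. t + x" lborel borel h] that distr_lborel_translation[of t] by simp
  have negL: "(\<integral>\<^sup>+x. h (- x) \<partial>lborel) = (\<integral>\<^sup>+x. h x \<partial>lborel)"
    if "h \<in> borel_measurable borel" for h :: "'a \<Rightarrow> ennreal"
    using nn_integral_distr[of "\<lambda>x. - x" lborel borel h] that distr_lborel_uminus[where 'a='a] by simp
  have "emeasure M A * emeasure lborel ?B = (\<integral>\<^sup>+x. indicator A x * (\<integral>\<^sup>+y. indicator ?B y \<partial>lborel) \<partial>M)"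
    by (simp add: nn_integral_multc)
  also have "\<dots> = (\<integral>\<^sup>+x. indicator A x * (\<integral>\<^sup>+y. indicator ?B (x + y) \<partial>lborel) \<partial>M)"
    by (subst shiftL, rule borel_measurable_indicator) simp_all
  also have "\<dots> = (\<integral>\<^sup>+x. \<integral>\<^sup>+y. indicator A x * indicator ?B (x + y) \<partial>lborel \<partial>M)"
    by (simp add: nn_integral_cmult)
  also have "\<dots> = (\<integral>\<^sup>+y. \<integral>\<^sup>+x. indicator A x * indicator ?B (x + y) \<partial>M \<partial>lborel)"
    by (rule P.Fubini'[symmetric]) measurable
  also have "\<dots> = (\<integral>\<^sup>+y. \<integral>\<^sup>+x. indicator A (- y + x) * indicator ?B x \<partial>M \<partial>lborel)"
  proof (rule nn_integral_cong)
    fix y :: 'a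
    have "(\<integral>\<^sup>+x. indicator A (- y + x) * indicator ?B ((- y + x) + y) \<partial>M)
        = (\<integral>\<^sup>+x. indicator A x * indicator ?B (x + y) \<partial>M)"
      by (rule shiftM[of "\<lambda>x. indicator A x * indicator ?B (x + y)" "- y"]) measurable
    then show "(\<integral>\<^sup>+x. indicator A x * indicator ?B (x + y) \<partial>M)
        = (\<integral>\<^sup>+x. indicator A (- y + x) * indicator ?B x \<partial>M)"
      by (simp add: algebra_simps)
  qed
  also have "\<dots> = (\<integral>\<^sup>+x. \<integral>\<^sup>+y. indicator A (- y + x) * indicator ?B x \<partial>lborel \<partial>M)"
    by (rule P.Fubini') measurable
  also have "\<dots> = (\<integral>\<^sup>+x. (\<integral>\<^sup>+y. indicator A (x + - y) \<partial>lborel) * indicator ?B x \<partial>M)"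
    by (simp add: nn_integral_multc add.commute)
  also have "\<dots> = (\<integral>\<^sup>+x. (\<integral>\<^sup>+y. indicator A y \<partial>lborel) * indicator ?B x \<partial>M)"
    by (subst negL, measurable, subst shiftL, simp_all)
  also have "\<dots> = emeasure lborel A * emeasure M ?B"
    using sets by (simp add: nn_integral_cmult)
  finally have eq: "emeasure M A * emeasure lborel ?B = emeasure lborel A * emeasure lborel ?B"
    using ball by simp
  have "emeasure lborel ?B = ennreal (unit_ball_vol DIM('a))"
    by (simp add: emeasure_cball)
  then have "emeasure lborel ?B \<noteq> 0" "emeasure lborel ?B \<noteq> top"
    using unit_ball_vol_pos[of "DIM('a)"] by (simp_all del: unit_ball_vol_pos)
  then show "emeasure M A = emeasure lborel A"
    using eq ennreal_mult_cancel_left[of "emeasure lborel ?B" "emeasure M A" "emeasure lborel A"]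
    by (metis mult.commute)
qed

text \<open>The image of Lebesgue measure under an orthogonal map is again translation invariant, since the map is
linear and onto, and it has the same unit ball because norms are preserved.\<close>

lemma distr_lborel_orthogonal:
  fixes T :: "'a::euclidean_space \<Rightarrow> 'a"
  assumes T: "orthogonal_transformation T"
  shows "distr lborel borel T = lborel"
proof (rule lborel_eq_of_translation_invariant)
  have lin: "linear T" using T by (simp add: orthogonal_transformation_def)
  have [measurable]: "T \<in> borel_measurable borel"
    using linear_continuous_on[of T UNIV] lin
    by (intro borel_measurable_continuous_onI) (simp add: linear_conv_bounded_linear)
  have nT: "norm (T x) = norm x" for x
    using T by (simp add: orthogonal_transformation)
  have pre: "T -` cball 0 r = cball 0 r" for r by (auto simp: nT)
  show "sigma_finite_measure (distr lborel borel T)"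
  proof
    show "\<exists>A. countable A \<and> A \<subseteq> sets (distr lborel borel T) \<and> \<Union> A = space (distr lborel borel T) \<and>
      (\<forall>a\<in>A. emeasure (distr lborel borel T) a \<noteq> \<infinity>)"
      by (intro exI[of _ "range (\<lambda>k::nat. cball 0 (real k))"])
        (auto simp: emeasure_distr pre emeasure_cball intro: real_arch_simple)
  qed
  show "distr (distr lborel borel T) borel (\<lambda>x. t + x) = distr lborel borel T" for t
  proof -
    obtain s where s: "T s = t"
      using orthogonal_transformation_surj[OF T] by (metis surjD)
    have "distr (distr lborel borel T) borel (\<lambda>x. t + x) = distr lborel borel (\<lambda>x. T (s + x))"
      by (simp add: distr_distr comp_def linear_add[OF lin] s)
    also have "\<dots> = distr (distr lborel borel (\<lambda>x. s + x)) borel T"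
      by (simp add: distr_distr comp_def)
    finally show ?thesis by (simp only: distr_lborel_translation)
  qed
  show "emeasure (distr lborel borel T) (cball 0 1) = emeasure lborel (cball (0::'a) 1)"
    by (simp add: emeasure_distr pre)
qed simp

section \<open>The singular kernel\<close>

text \<open>A substitute for polar coordinates: a function with a power singularity is compared on each dyadic
shell with a constant on the ball that contains the shell.\<close>

lemma integrable_dominated_by_ball_sum:
  fixes g :: "'a::euclidean_space \<Rightarrow> real"
  assumes [measurable]: "g \<in> borel_measurable borel"
    and bound: "\<And>y. g y \<noteq> 0 \<Longrightarrow> \<exists>k. norm y \<le> r k \<and> \<bar>g y\<bar> \<le> a k"
    and a: "\<And>k. 0 \<le> a k" and r: "\<And>k::nat. 0 \<le> r k"
    and sum: "summable (\<lambda>k. a k * r k ^ DIM('a))"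
  shows "integrable lborel g"
proof (rule integrableI_bounded)
  have "(\<integral>\<^sup>+y. ennreal (norm (g y)) \<partial>lborel)
      \<le> (\<integral>\<^sup>+(y::'a). (\<Sum>k. ennreal (a k) * indicator (cball 0 (r k)) y) \<partial>lborel)"
  proof (rule nn_integral_mono)
    fix y :: 'a
    show "ennreal (norm (g y)) \<le> (\<Sum>k. ennreal (a k) * indicator (cball 0 (r k)) y)"
    proof (cases "g y = 0")
      case False
      then obtain k where k: "norm y \<le> r k" "\<bar>g y\<bar> \<le> a k" using bound by blast
      have "ennreal (norm (g y)) \<le> (\<Sum>i\<in>{k}. ennreal (a i) * indicator (cball 0 (r i)) y)"
        using k by (simp add: ennreal_leI)
      also have "\<dots> \<le> (\<Sum>i. ennreal (a i) * indicator (cball 0 (r i)) y)"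
        by (rule sum_le_suminf) auto
      finally show ?thesis .
    qed simp
  qed
  also have "\<dots> = (\<Sum>k. ennreal (unit_ball_vol DIM('a) * (a k * r k ^ DIM('a))))"
  proof -
    have [measurable]: "cball (0::'a) (r k) \<in> sets borel" for k by simp
    have "(\<integral>\<^sup>+(y::'a). ennreal (a k) * indicator (cball 0 (r k)) y \<partial>lborel)
        = ennreal (unit_ball_vol DIM('a) * (a k * r k ^ DIM('a)))" for k
      using a[of k] r[of k]
      by (subst nn_integral_cmult_indicator) (auto simp: emeasure_cball ennreal_mult'[symmetric] mult_ac)
    then show ?thesis by (subst nn_integral_suminf) simp_all
  qed
  also have "\<dots> < \<infinity>"
    using sum a r by (subst suminf_ennreal2) (auto intro!: summable_mult mult_nonneg_nonneg)
  finally show "(\<integral>\<^sup>+y. ennreal (norm (g y)) \<partial>lborel) < \<infinity>" .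
qed simp

text \<open>At the origin the kernel takes the value \<open>0\<close>, the value of \<open>0 powr a\<close>; the origin is a null
set.\<close>

definition kernel :: "real \<Rightarrow> real^'n \<Rightarrow> real" where
  "kernel \<alpha> y = norm y powr - (real CARD('n) + \<alpha>)"

lemma kernel_nonneg [simp]: "0 \<le> kernel \<alpha> y"
  by (simp add: kernel_def)

lemma kernel_uminus [simp]: "kernel \<alpha> (- y) = kernel \<alpha> y"
  by (simp add: kernel_def)

lemma measurable_kernel [measurable]: "kernel \<alpha> \<in> borel_measurable borel"
  unfolding kernel_def by measurable

lemma kernel_scale:
  fixes y :: "real^'n"
  assumes "0 < c"
  shows "kernel \<alpha> (c *\<^sub>R y) = c powr - (real CARD('n) + \<alpha>) * kernel \<alpha> y"
  using assms by (simp add: kernel_def powr_mult)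

text \<open>The function whose integrability says that \<open>kernel \<alpha> y dy\<close> is a Levy measure. Up to constant factors it
dominates the integrands below: those integrands vanish to second order at the origin and are bounded at infinity,
apart from the factor \<open>kernel\<close>.\<close>

definition levy_kernel :: "real \<Rightarrow> real^'n \<Rightarrow> real" where
  "levy_kernel \<alpha> y = min 1 ((norm y)\<^sup>2) * kernel \<alpha> y"

lemma measurable_levy_kernel [measurable]: "levy_kernel \<alpha> \<in> borel_measurable borel"
  unfolding levy_kernel_def by measurable

lemma levy_kernel_nonneg [simp]: "0 \<le> levy_kernel \<alpha> y"
  by (simp add: levy_kernel_def)

text \<open>On the shell \<open>2^k \<le> |y| \<le> 2^(k+1)\<close> the integral is of order \<open>2 powr (-k \<alpha>)\<close>, which is
summable as \<open>\<alpha> > 0\<close>; on \<open>2^(-k-1) \<le> |y| \<le> 2^-k\<close> the factor \<open>|y|\<^sup>2\<close> improves the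
order to \<open>2 powr (-k (2 - \<alpha>))\<close>, which is summable as \<open>\<alpha> < 2\<close>.\<close>

lemma integrable_levy_kernel:
  assumes "0 < \<alpha>" "\<alpha> < 2"
  shows "integrable lborel (levy_kernel \<alpha> :: real^'n \<Rightarrow> real)"
proof -
  define n where "n = real CARD('n)"
  let ?L = "levy_kernel \<alpha> :: real^'n \<Rightarrow> real"
  have n: "0 < n" by (simp add: n_def)
  have pn: "(2 powr t) ^ CARD('n) = 2 powr (n * t)" for t :: real
    by (simp add: n_def powr_power)
  have geo: "summable (\<lambda>k. c * 2 powr (real k * - s))" if "0 < s" for c s :: real
  proof -
    have "2 powr (real k * - s) = (2 powr - s) ^ k" for k
      by (simp add: powr_realpow[symmetric] powr_powr mult.commute)
    then show ?thesis using that
      by (simp add: summable_mult summable_geometric powr_less_one)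
  qed
  have out: "integrable lborel (\<lambda>y. indicator {y. 1 \<le> norm y} y * ?L y)"
  proof (rule integrable_dominated_by_ball_sum[where a = "\<lambda>k. 2 powr (- real k * (n + \<alpha>))"
        and r = "\<lambda>k. 2 powr (real k + 1)"])
    fix y :: "real^'n"
    assume "indicator {y. 1 \<le> norm y} y * ?L y \<noteq> 0"
    then have y: "1 \<le> norm y" by (simp add: indicator_def split: if_splits)
    define k where "k = nat \<lfloor>log 2 (norm y)\<rfloor>"
    have y0: "0 < norm y" using y by linarith
    have l0: "0 \<le> log 2 (norm y)" using y y0 by simp
    have k: "real k \<le> log 2 (norm y)" "log 2 (norm y) \<le> real k + 1"
      using l0 unfolding k_def by linarith+
    have ny: "norm y = 2 powr (log 2 (norm y))" using y by (subst powr_log_cancel) auto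
    have "norm y \<le> 2 powr (real k + 1)" by (subst ny) (use k in simp)
    moreover have "kernel \<alpha> y \<le> 2 powr (- real k * (n + \<alpha>))"
      unfolding kernel_def n_def[symmetric]
      by (subst ny, subst powr_powr)
        (use mult_right_mono[OF k(1), of "n + \<alpha>"] n assms in \<open>simp add: algebra_simps\<close>)
    moreover have "?L y \<le> kernel \<alpha> y"
      unfolding levy_kernel_def by (intro mult_left_le_one_le) auto
    ultimately show "\<exists>k. norm y \<le> 2 powr (real k + 1) \<and>
        \<bar>indicator {y. 1 \<le> norm y} y * ?L y\<bar> \<le> 2 powr (- real k * (n + \<alpha>))"
      using y by (intro exI[of _ k]) auto
  next
    have "2 powr (- real k * (n + \<alpha>)) * (2 powr (real k + 1)) ^ DIM(real^'n)
        = 2 powr n * 2 powr (real k * - \<alpha>)" for k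
      by (simp add: pn powr_add[symmetric] algebra_simps)
    then show "summable (\<lambda>k. 2 powr (- real k * (n + \<alpha>)) * (2 powr (real k + 1)) ^ DIM(real^'n))"
      using geo[of \<alpha> "2 powr n"] assms by simp
  qed auto
  have inn: "integrable lborel (\<lambda>y. indicator {y. norm y < 1} y * ?L y)"
  proof (rule integrable_dominated_by_ball_sum[where
        a = "\<lambda>k. 2 powr (- 2 * real k + (real k + 1) * (n + \<alpha>))" and r = "\<lambda>k. 2 powr (- real k)"])
    fix y :: "real^'n"
    assume "indicator {y. norm y < 1} y * ?L y \<noteq> 0"
    then have y: "norm y < 1" "y \<noteq> 0"
      by (auto simp: indicator_def levy_kernel_def split: if_splits)
    define k where "k = nat \<lfloor>- log 2 (norm y)\<rfloor>"
    have l0: "0 \<le> - log 2 (norm y)" using y by simp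
    have k: "real k \<le> - log 2 (norm y)" "- log 2 (norm y) \<le> real k + 1"
      using l0 unfolding k_def by linarith+
    have ny: "norm y = 2 powr (log 2 (norm y))" using y by (subst powr_log_cancel) auto
    have le: "norm y \<le> 2 powr (- real k)" by (subst ny) (use k in simp)
    have "(norm y)\<^sup>2 \<le> (2 powr (- real k))\<^sup>2" using le by (intro power_mono) auto
    also have "\<dots> = 2 powr (- 2 * real k)" by (simp add: powr_power)
    finally have sq: "(norm y)\<^sup>2 \<le> 2 powr (- 2 * real k)" .
    have "- (log 2 (norm y) * (n + \<alpha>)) \<le> (real k + 1) * (n + \<alpha>)"
      using mult_right_mono[OF k(2), of "n + \<alpha>"] n assms by simp
    then have ke: "kernel \<alpha> y \<le> 2 powr ((real k + 1) * (n + \<alpha>))"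
      unfolding kernel_def n_def[symmetric]
      by (subst ny, subst powr_powr) (simp add: algebra_simps)
    have "?L y \<le> (norm y)\<^sup>2 * kernel \<alpha> y"
      unfolding levy_kernel_def by (intro mult_right_mono) auto
    also have "\<dots> \<le> 2 powr (- 2 * real k) * 2 powr ((real k + 1) * (n + \<alpha>))"
      using sq ke by (intro mult_mono) auto
    finally show "\<exists>k. norm y \<le> 2 powr (- real k) \<and> \<bar>indicator {y. norm y < 1} y * ?L y\<bar>
        \<le> 2 powr (- 2 * real k + (real k + 1) * (n + \<alpha>))"
      using y le by (intro exI[of _ k]) (auto simp: powr_add[symmetric])
  next
    have "2 powr (- 2 * real k + (real k + 1) * (n + \<alpha>)) * (2 powr (- real k)) ^ DIM(real^'n)
        = 2 powr (n + \<alpha>) * 2 powr (real k * - (2 - \<alpha>))" for k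
      by (simp add: pn powr_add[symmetric] algebra_simps)
    then show "summable (\<lambda>k. 2 powr (- 2 * real k + (real k + 1) * (n + \<alpha>)) * (2 powr (- real k)) ^ DIM(real^'n))"
      using geo[of "2 - \<alpha>" "2 powr (n + \<alpha>)"] assms by simp
  qed auto
  have "?L = (\<lambda>y. indicator {y. 1 \<le> norm y} y * ?L y + indicator {y. norm y < 1} y * ?L y)"
    by (auto simp: indicator_def fun_eq_iff)
  then show ?thesis using Bochner_Integration.integrable_add[OF out inn] by simp
qed

section \<open>The symbol of the singular integral\<close>

text \<open>The factor by which the singular integral operator acts on the plane wave with frequency \<open>\<xi>\<close>: the
symmetric second difference of that wave is \<open>2 (1 - cos (\<xi> \<bullet> y))\<close> times the wave, and the imaginary parts
cancel.\<close>

definition symbol :: "real \<Rightarrow> real^'n \<Rightarrow> real" where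
  "symbol \<alpha> \<xi> = (LINT y|lborel. (1 - cos (\<xi> \<bullet> y)) * kernel \<alpha> y)"

lemma one_minus_cos_le: "1 - cos t \<le> 2 * min 1 (t\<^sup>2)" for t :: real
proof -
  have "1 - cos t = 2 * (sin (t/2))\<^sup>2"
    using cos_double_sin[of "t/2"] by simp
  moreover have "(sin (t/2))\<^sup>2 \<le> t\<^sup>2"
    using abs_sin_x_le_abs_x[of "t/2"] by (intro abs_le_square_iff[THEN iffD1]) simp
  moreover have "(sin (t/2))\<^sup>2 \<le> 1" by (simp add: abs_square_le_1)
  ultimately show ?thesis by simp
qed

lemma integrable_symbol:
  fixes \<xi> :: "real^'n"
  assumes "0 < \<alpha>" "\<alpha> < 2"
  shows "integrable lborel (\<lambda>y. (1 - cos (\<xi> \<bullet> y)) * kernel \<alpha> y)"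
proof (rule Bochner_Integration.integrable_bound)
  show "integrable lborel (\<lambda>y. 2 * (1 + (norm \<xi>)\<^sup>2) * levy_kernel \<alpha> y :: real)"
    by (intro integrable_mult_right integrable_levy_kernel assms)
  show "AE y in lborel. norm ((1 - cos (\<xi> \<bullet> y)) * kernel \<alpha> y) \<le> norm (2 * (1 + (norm \<xi>)\<^sup>2) * levy_kernel \<alpha> y)"
  proof (intro always_eventually allI)
    fix y
    have "(\<xi> \<bullet> y)\<^sup>2 \<le> (norm \<xi>)\<^sup>2 * (norm y)\<^sup>2"
      using Cauchy_Schwarz_ineq[of \<xi> y] by (simp add: power2_norm_eq_inner)
    then have "min 1 ((\<xi> \<bullet> y)\<^sup>2) \<le> (1 + (norm \<xi>)\<^sup>2) * min 1 ((norm y)\<^sup>2)"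
      by (auto simp: min_def algebra_simps)
         (smt (verit) mult_left_mono zero_le_power2 mult_nonneg_nonneg)+
    then have "1 - cos (\<xi> \<bullet> y) \<le> 2 * (1 + (norm \<xi>)\<^sup>2) * min 1 ((norm y)\<^sup>2)"
      using one_minus_cos_le[of "\<xi> \<bullet> y"] unfolding mult.assoc by linarith
    from mult_right_mono[OF this kernel_nonneg[of \<alpha> y]]
    show "norm ((1 - cos (\<xi> \<bullet> y)) * kernel \<alpha> y) \<le> norm (2 * (1 + (norm \<xi>)\<^sup>2) * levy_kernel \<alpha> y)"
      by (simp add: levy_kernel_def abs_mult mult_ac)
  qed
qed measurable

lemma symbol_scale:
  fixes \<xi> :: "real^'n"
  assumes "0 < r"
  shows "symbol \<alpha> (r *\<^sub>R \<xi>) = r powr \<alpha> * symbol \<alpha> \<xi>"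
proof -
  have "symbol \<alpha> \<xi> = r ^ CARD('n) * (LINT y|lborel. (1 - cos (\<xi> \<bullet> (r *\<^sub>R y))) * kernel \<alpha> (r *\<^sub>R y))"
    unfolding symbol_def using assms
    by (subst integral_lborel_scale[where f = "\<lambda>y. (1 - cos (\<xi> \<bullet> y)) * kernel \<alpha> y"]) auto
  also have "\<dots> = r ^ CARD('n) * (LINT y|lborel. r powr - (real CARD('n) + \<alpha>) * ((1 - cos ((r *\<^sub>R \<xi>) \<bullet> y)) * kernel \<alpha> y))"
    using assms by (simp add: kernel_scale mult_ac)
  also have "\<dots> = r ^ CARD('n) * r powr - (real CARD('n) + \<alpha>) * symbol \<alpha> (r *\<^sub>R \<xi>)"
    by (simp add: symbol_def)
  also have "r ^ CARD('n) * r powr - (real CARD('n) + \<alpha>) = r powr - \<alpha>"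
    using assms by (simp add: powr_realpow[symmetric] powr_add[symmetric])
  finally show ?thesis using assms by (simp add: powr_minus field_simps)
qed

lemma symbol_rotation:
  fixes T :: "real^'n \<Rightarrow> real^'n"
  assumes T: "orthogonal_transformation T"
  shows "symbol \<alpha> (T \<xi>) = symbol \<alpha> \<xi>"
proof -
  have "linear T" using T by (simp add: orthogonal_transformation_def)
  then have m: "T \<in> borel_measurable borel"
    using linear_continuous_on[of T UNIV]
    by (intro borel_measurable_continuous_onI) (simp add: linear_conv_bounded_linear)
  have "symbol \<alpha> (T \<xi>) = (LINT y|lborel. (1 - cos (T \<xi> \<bullet> T y)) * kernel \<alpha> (T y))"
    unfolding symbol_def
    by (rule integral_lborel_invariant[OF distr_lborel_orthogonal[OF T] m, symmetric]) measurable
  also have "\<dots> = symbol \<alpha> \<xi>"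
  proof -
    have "norm (T y) = norm y" for y using T by (simp add: orthogonal_transformation)
    moreover have "T v \<bullet> T y = v \<bullet> y" for v y using T by (simp add: orthogonal_transformation_def)
    ultimately show ?thesis by (simp only: symbol_def kernel_def)
  qed
  finally show ?thesis .
qed

text \<open>By rotation invariance any unit vector serves as the reference frequency; the index \<open>undefined\<close> picks
some coordinate axis.\<close>

definition symbol_const :: "real \<Rightarrow> 'n::finite itself \<Rightarrow> real" where
  "symbol_const \<alpha> _ = symbol \<alpha> (axis undefined 1 :: real^'n)"

text \<open>Rotate the reference unit vector into the direction of \<open>\<xi>\<close> and scale by \<open>|\<xi>|\<close>.\<close>

lemma symbol_eq:
  fixes \<xi> :: "real^'n"
  shows "symbol \<alpha> \<xi> = symbol_const \<alpha> TYPE('n) * norm \<xi> powr \<alpha>"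
proof (cases "\<xi> = 0")
  case False
  let ?e = "axis undefined 1 :: real^'n"
  obtain T where T: "orthogonal_transformation T" "T ?e = (1 / norm \<xi>) *\<^sub>R \<xi>"
    using orthogonal_transformation_exists[of ?e "(1 / norm \<xi>) *\<^sub>R \<xi>"] False by auto
  have "symbol \<alpha> \<xi> = symbol \<alpha> (norm \<xi> *\<^sub>R T ?e)" using False T by simp
  also have "\<dots> = norm \<xi> powr \<alpha> * symbol \<alpha> ?e"
    using symbol_scale[of "norm \<xi>" \<alpha> "T ?e"] symbol_rotation[OF T(1), of \<alpha> ?e] False by simp
  finally show ?thesis by (simp add: symbol_const_def mult.commute)
qed (simp add: symbol_def)

text \<open>The integrand is nonnegative, and it is positive on the unit ball around the reference vector: there the
reference coordinate lies in \<open>(0, 2)\<close>, inside a period of the cosine.\<close>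

lemma symbol_const_pos:
  assumes "0 < \<alpha>" "\<alpha> < 2"
  shows "0 < symbol_const \<alpha> TYPE('n::finite)"
proof -
  let ?e = "axis undefined 1 :: real^'n"
  let ?g = "\<lambda>y. (1 - cos (?e \<bullet> y)) * kernel \<alpha> y"
  have nn: "0 \<le> ?g y" for y by (intro mult_nonneg_nonneg) auto
  have "symbol \<alpha> ?e \<noteq> 0"
  proof
    assume "symbol \<alpha> ?e = 0"
    then have "AE y in lborel. ?g y = 0"
      unfolding symbol_def
      using integral_nonneg_eq_0_iff_AE[OF integrable_symbol[OF assms, of ?e]] nn by simp
    moreover have "?g y \<noteq> 0" if "y \<in> ball ?e 1" for y
    proof -
      have "\<bar>(?e - y) $ undefined\<bar> < 1"
        using that component_le_norm_cart[of "?e - y" undefined] by (simp add: dist_norm)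
      then have c: "0 < y $ undefined" "y $ undefined < 2" by (auto simp: axis_def)
      have "cos (y $ undefined) < cos 0"
        using c pi_gt3 by (intro cos_monotone_0_pi) auto
      moreover have "?e \<bullet> y = y $ undefined" by (simp add: inner_axis')
      moreover have "y \<noteq> 0" using c by auto
      ultimately show ?thesis by (simp add: kernel_def)
    qed
    ultimately have "AE y in lborel. y \<notin> ball ?e 1" by (auto elim: AE_mp)
    then have "emeasure lborel (ball ?e 1) = 0"
      by (subst (asm) AE_iff_measurable[of "ball ?e 1"]) auto
    then show False using unit_ball_vol_pos[of "CARD('n)"] by (simp add: emeasure_ball del: unit_ball_vol_pos)
  qed
  moreover have "0 \<le> symbol \<alpha> ?e" unfolding symbol_def using nn by (intro Bochner_Integration.integral_nonneg) auto
  ultimately show ?thesis by (simp add: symbol_const_def)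
qed

section \<open>Decay estimates for Schwartz functions\<close>

definition decay :: "nat \<Rightarrow> real^'n \<Rightarrow> real" where
  "decay N x = 1 / (1 + norm x) ^ N"

lemma one_plus_norm_pos [simp]: "0 < 1 + norm x"
  by (simp add: add_pos_nonneg)

lemma decay_pos [simp]: "0 < decay N x"
  by (simp add: decay_def)

lemma decay_nonneg [simp]: "0 \<le> decay N x"
  by (simp add: less_imp_le)

lemma decay_le_1: "decay N x \<le> 1"
  by (simp add: decay_def)

lemma measurable_decay [measurable]: "decay N \<in> borel_measurable borel"
  unfolding decay_def by measurable

text \<open>Lets a supremum over a unit ball be estimated by the weight at its centre.\<close>

lemma decay_nearby:
  assumes "norm (z - x) \<le> 1"
  shows "decay N z \<le> 2 ^ N * decay N x"
proof -
  have "norm x \<le> norm z + norm (z - x)" using norm_triangle_ineq4[of z "z - x"] by simp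
  then have "1 + norm x \<le> 2 * (1 + norm z)"
    using assms by (smt (verit) norm_ge_zero)
  then have "(1 + norm x) ^ N \<le> (2 * (1 + norm z)) ^ N" by (intro power_mono) auto
  then show ?thesis unfolding decay_def power_mult_distrib
    by (simp add: field_simps add_pos_nonneg)
qed

text \<open>Outside the unit ball \<open>decay N\<close> is at most \<open>|x| powr -(n + 1)\<close>, which is \<open>levy_kernel 1\<close>.\<close>

lemma integrable_decay:
  assumes "CARD('n) < N"
  shows "integrable lborel (decay N :: real^'n \<Rightarrow> real)"
proof (rule Bochner_Integration.integrable_bound)
  let ?B = "cball 0 1 :: (real^'n) set"
  have "emeasure lborel ?B < \<infinity>" by (simp add: emeasure_cball)
  then have "integrable lborel (indicator ?B :: real^'n \<Rightarrow> real)"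
    by (intro integrable_real_indicator) auto
  then show "integrable lborel (\<lambda>x::real^'n. indicator ?B x + levy_kernel 1 x)"
    using integrable_levy_kernel[of 1, where 'n='n] by (intro Bochner_Integration.integrable_add) auto
  show "AE x in lborel. norm (decay N x) \<le> norm (indicator ?B x + levy_kernel 1 x)"
  proof (intro always_eventually allI)
    fix x :: "real^'n"
    show "norm (decay N x) \<le> norm (indicator ?B x + levy_kernel 1 x)"
    proof (cases "norm x \<le> 1")
      case True
      then show ?thesis using decay_le_1[of N x] by (simp add: add_increasing2)
    next
      case False
      then have n0: "0 < norm x" by linarith
      have "norm x ^ (CARD('n) + 1) \<le> (1 + norm x) ^ (CARD('n) + 1)" by (intro power_mono) auto
      also have "\<dots> \<le> (1 + norm x) ^ N" using assms by (intro power_increasing) auto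
      finally have "decay N x \<le> 1 / norm x ^ (CARD('n) + 1)"
        unfolding decay_def using n0 by (intro divide_left_mono) (auto intro!: mult_pos_pos)
      also have "\<dots> = kernel 1 x"
        using powr_realpow[OF n0, of "CARD('n) + 1"]
        by (subst kernel_def, subst powr_minus) (simp add: field_simps)
      also have "\<dots> = levy_kernel 1 x" using False by (simp add: levy_kernel_def)
      finally show ?thesis using False by simp
    qed
  qed
qed simp

lemma schwartz_decay:
  fixes f :: "real^'n \<Rightarrow> real"
  assumes "schwartz f"
  shows "\<exists>C\<ge>0. \<forall>x. \<bar>partials is f x\<bar> \<le> C * decay N x"
proof -
  have "bounded (range (\<lambda>x. norm x ^ m * partials is f x))" for m
    using assms by (simp add: schwartz_def)
  then have "\<exists>B. \<forall>x. norm x ^ m * \<bar>partials is f x\<bar> \<le> B" for m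
    unfolding bounded_iff by (simp add: abs_mult)
  then obtain B where B: "\<And>m x. norm x ^ m * \<bar>partials is f x\<bar> \<le> B m" by metis
  have le: "\<bar>partials is f x\<bar> \<le> 2 ^ N * (B 0 + B N) * decay N x" for x
  proof -
    have "(1 + norm x) ^ N \<le> (2 * max 1 (norm x)) ^ N" by (intro power_mono) auto
    also have "\<dots> \<le> 2 ^ N * (1 + norm x ^ N)"
      by (auto simp: power_mult_distrib max_def)
    finally have "(1 + norm x) ^ N * \<bar>partials is f x\<bar> \<le> 2 ^ N * (1 + norm x ^ N) * \<bar>partials is f x\<bar>"
      by (intro mult_right_mono) auto
    also have "\<dots> = 2 ^ N * (norm x ^ 0 * \<bar>partials is f x\<bar> + norm x ^ N * \<bar>partials is f x\<bar>)"
      by (simp add: algebra_simps)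
    also have "\<dots> \<le> 2 ^ N * (B 0 + B N)"
      using B[of x 0] B[of x N] by (intro mult_left_mono add_mono) auto
    finally show ?thesis by (simp add: decay_def field_simps add_pos_nonneg)
  qed
  have "0 \<le> B m" for m using B[of 0 m] by (smt (verit) zero_le_power norm_ge_zero mult_nonneg_nonneg)
  then show ?thesis using le by (intro exI[of _ "2 ^ N * (B 0 + B N)"]) auto
qed

lemma schwartz_has_derivative:
  fixes f :: "real^'n \<Rightarrow> real"
  assumes "schwartz f"
  shows "(partials is f has_derivative (\<lambda>v. \<Sum>i\<in>UNIV. v $ i * partials (i # is) f x)) (at x)"
proof -
  let ?D = "frechet_derivative (partials is f) (at x)"
  have d: "(partials is f has_derivative ?D) (at x)"
    using assms by (simp add: schwartz_def frechet_derivative_works[symmetric] differentiable_on_def)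
  then have lin: "linear ?D" by (rule has_derivative_linear)
  have "?D v = (\<Sum>i\<in>UNIV. v $ i * partials (i # is) f x)" for v
  proof -
    have "?D v = ?D (\<Sum>i\<in>UNIV. v $ i *\<^sub>R axis i 1)"
      using basis_expansion[of v] by (simp add: scalar_mult_eq_scaleR)
    also have "\<dots> = (\<Sum>i\<in>UNIV. v $ i * partials (i # is) f x)"
      by (simp add: linear_sum[OF lin] linear_scale[OF lin])
    finally show ?thesis .
  qed
  then show ?thesis using d by (metis (no_types, lifting) ext)
qed

lemma schwartz_line_derivative:
  fixes f :: "real^'n \<Rightarrow> real"
  assumes "schwartz f"
  shows "((\<lambda>t. partials is f (x + t *\<^sub>R y)) has_real_derivative
           (\<Sum>i\<in>UNIV. y $ i * partials (i # is) f (x + t *\<^sub>R y))) (at t)"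
proof -
  have "((\<lambda>t. x + t *\<^sub>R y) has_derivative (\<lambda>s. s *\<^sub>R y)) (at t)"
    by (auto intro!: derivative_eq_intros)
  from has_derivative_compose[OF this schwartz_has_derivative[OF assms, of "is" "x + t *\<^sub>R y"]]
  show ?thesis
    by (rule has_derivative_imp_has_field_derivative) (simp add: sum_distrib_left mult_ac)
qed

lemma continuous_on_schwartz: "schwartz f \<Longrightarrow> continuous_on UNIV f"
  using differentiable_imp_continuous_on[of f UNIV] unfolding schwartz_def
  by (metis partials.simps(1))

lemma measurable_schwartz: "schwartz f \<Longrightarrow> f \<in> borel_measurable borel"
  by (intro borel_measurable_continuous_onI continuous_on_schwartz)

lemma schwartz_lipschitz:
  fixes f :: "real^'n \<Rightarrow> real"
  assumes "schwartz f"
  shows "\<exists>L\<ge>0. \<forall>x y. \<bar>f (x + y) - f x\<bar> \<le> L * norm y"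
proof -
  have "\<exists>C\<ge>0. \<forall>x. \<bar>partials [i] f x\<bar> \<le> C" for i
    using schwartz_decay[OF assms, of "[i]" 0] by (simp add: decay_def)
  then obtain C where C: "\<And>i. 0 \<le> C i" "\<And>i x. \<bar>partials [i] f x\<bar> \<le> C i" by metis
  have "\<bar>f (x + y) - f x\<bar> \<le> (\<Sum>i\<in>UNIV. C i) * norm y" for x y
  proof -
    obtain t where t: "f (x + 1 *\<^sub>R y) - f (x + 0 *\<^sub>R y)
        = (1 - 0) * (\<Sum>i\<in>UNIV. y $ i * partials [i] f (x + t *\<^sub>R y))"
      using MVT2[of 0 1 "\<lambda>t. f (x + t *\<^sub>R y)" "\<lambda>t. \<Sum>i\<in>UNIV. y $ i * partials [i] f (x + t *\<^sub>R y)"]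
        schwartz_line_derivative[OF assms, of "[]" x y] by auto
    then have "\<bar>f (x + y) - f x\<bar> \<le> (\<Sum>i\<in>UNIV. \<bar>y $ i * partials [i] f (x + t *\<^sub>R y)\<bar>)"
      by (simp del: partials.simps)
    also have "\<dots> \<le> (\<Sum>i\<in>UNIV. C i * norm y)"
      unfolding abs_mult
      by (intro sum_mono) (subst mult.commute, intro mult_mono C component_le_norm_cart, auto)
    finally show ?thesis by (simp add: sum_distrib_right)
  qed
  then show ?thesis using C by (intro exI[of _ "\<Sum>i\<in>UNIV. C i"]) (auto intro: sum_nonneg)
qed

text \<open>Twice the average of \<open>f x - f (x + y)\<close> over \<open>y\<close> and \<open>- y\<close>: the first order term that makes
the principal value only conditionally convergent cancels.\<close>

definition second_diff :: "(real^'n \<Rightarrow> real) \<Rightarrow> real^'n \<Rightarrow> real^'n \<Rightarrow> real" where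
  "second_diff f x y = 2 * f x - f (x + y) - f (x - y)"

text \<open>The weight matching \<open>second_diff\<close>. Its integral over \<open>x\<close> does not depend on \<open>y\<close>, which is
what an application of Fubini's theorem needs.\<close>

definition decay3 :: "nat \<Rightarrow> real^'n \<Rightarrow> real^'n \<Rightarrow> real" where
  "decay3 N x y = 2 * decay N x + decay N (x + y) + decay N (x - y)"

text \<open>For \<open>|y| \<ge> 1\<close> bound the three terms separately. For \<open>|y| \<le> 1\<close> use Taylor's formula of order two
for \<open>f (x + t y) + f (x - t y)\<close>, whose first derivative vanishes at \<open>t = 0\<close>; the second
derivative is evaluated at distance at most one from \<open>x\<close>, so that the weight there is comparable to
the weight at \<open>x\<close>.\<close>

lemma second_diff_bound:
  fixes f :: "real^'n \<Rightarrow> real"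
  assumes f: "schwartz f"
  shows "\<exists>C\<ge>0. \<forall>x y. \<bar>second_diff f x y\<bar> \<le> C * decay3 N x y * min 1 ((norm y)\<^sup>2)"
proof -
  obtain C0 where C0: "0 \<le> C0" "\<And>x. \<bar>f x\<bar> \<le> C0 * decay N x"
    using schwartz_decay[OF f, of "[]" N] by auto
  define C where "C i j = (SOME c. 0 \<le> c \<and> (\<forall>x. \<bar>partials [j, i] f x\<bar> \<le> c * decay N x))" for i j
  have C: "0 \<le> C i j" "\<bar>partials [j, i] f x\<bar> \<le> C i j * decay N x" for i j x
    using someI_ex[OF schwartz_decay[OF f, of "[j, i]" N]] unfolding C_def by auto
  define G where "G = (\<Sum>i\<in>UNIV. \<Sum>j\<in>UNIV. C i j)"
  have G: "0 \<le> G" unfolding G_def using C by (intro sum_nonneg)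
  \<comment> \<open>The second derivative of \<open>f\<close> at \<open>z\<close> in the direction \<open>y\<close>.\<close>
  define Q where "Q z y = (\<Sum>i\<in>UNIV. y $ i * (\<Sum>j\<in>UNIV. y $ j * partials [j, i] f z))" for z y
  have Q: "\<bar>Q z y\<bar> \<le> G * (norm y)\<^sup>2 * decay N z" for z y
  proof -
    have "\<bar>Q z y\<bar> \<le> (\<Sum>i\<in>UNIV. \<bar>y $ i\<bar> * (\<Sum>j\<in>UNIV. \<bar>y $ j\<bar> * \<bar>partials [j, i] f z\<bar>))"
      unfolding Q_def
      by (rule order_trans[OF sum_abs], rule sum_mono, subst abs_mult, rule mult_left_mono,
          rule order_trans[OF sum_abs]) (simp_all add: abs_mult del: partials.simps)
    also have "\<dots> \<le> (\<Sum>i\<in>UNIV. norm y * (\<Sum>j\<in>UNIV. norm y * (C i j * decay N z)))"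
      by (intro sum_mono mult_mono component_le_norm_cart C sum_nonneg) (auto simp del: partials.simps)
    also have "\<dots> = G * (norm y)\<^sup>2 * decay N z"
      by (simp add: G_def sum_distrib_left sum_distrib_right power2_eq_square mult_ac)
    finally show ?thesis .
  qed
  have near: "\<bar>second_diff f x y\<bar> \<le> G * 2 ^ N * decay N x * (norm y)\<^sup>2" if y: "norm y \<le> 1" for x y
  proof -
    \<comment> \<open>The function \<open>f (x + t y) + f (x - t y)\<close> of \<open>t\<close> with its first two derivatives.\<close>
    let ?d = "\<lambda>m::nat. \<lambda>t::real. if m = 0 then f (x + t *\<^sub>R y) + f (x + t *\<^sub>R (- y))
       else if m = 1 then (\<Sum>i\<in>UNIV. y $ i * partials [i] f (x + t *\<^sub>R y))
          + (\<Sum>i\<in>UNIV. (- y) $ i * partials [i] f (x + t *\<^sub>R (- y)))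
       else Q (x + t *\<^sub>R y) y + Q (x + t *\<^sub>R (- y)) (- y)"
    have d: "DERIV (?d m) t :> ?d (Suc m) t" if "m < 2" for m t
    proof -
      have *: "((\<lambda>t. \<Sum>i\<in>UNIV. z $ i * partials [i] f (x + t *\<^sub>R z)) has_real_derivative Q (x + t *\<^sub>R z) z) (at t)" for z
        unfolding Q_def
        by (intro DERIV_sum DERIV_cmult schwartz_line_derivative f)
      have "m = 0 \<or> m = 1" using that by linarith
      then show ?thesis
        using schwartz_line_derivative[OF f, of "[]" x y t]
          schwartz_line_derivative[OF f, of "[]" x "-y" t] *[of y] *[of "-y"]
        by (elim disjE) (auto simp del: partials.simps(2) intro!: DERIV_add)
    qed
    obtain t where t: "0 < t" "t < 1" and
      eq: "?d 0 1 = (\<Sum>m<2. (?d m 0 / fact m) * 1 ^ m) + (?d 2 t / fact 2) * 1 ^ 2"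
      using Maclaurin[of 1 2 ?d "?d 0"] d by auto
    let ?S = "Q (x + t *\<^sub>R y) y + Q (x + t *\<^sub>R (- y)) (- y)"
    have "second_diff f x y = - ?S / 2"
    proof -
      have "f (x + y) + f (x - y) = 2 * f x + ?S / 2"
        using eq by (simp add: numeral_2_eq_2 sum_negf del: partials.simps)
      then show ?thesis unfolding second_diff_def by (simp add: field_simps)
    qed
    moreover have "\<bar>Q (x + t *\<^sub>R z) z\<bar> \<le> G * (norm y)\<^sup>2 * (2 ^ N * decay N x)" if z: "norm z = norm y" for z
    proof (rule order_trans[OF Q[of "x + t *\<^sub>R z" z]])
      have "t * norm y \<le> 1" using t y by (simp add: mult_le_one)
      then have "decay N (x + t *\<^sub>R z) \<le> 2 ^ N * decay N x"
        using t z by (intro decay_nearby) simp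
      then show "G * (norm z)\<^sup>2 * decay N (x + t *\<^sub>R z) \<le> G * (norm y)\<^sup>2 * (2 ^ N * decay N x)"
        unfolding z using G by (intro mult_left_mono) auto
    qed
    from this[of y] this[of "- y"]
    have "\<bar>?S\<bar> \<le> 2 * (G * (norm y)\<^sup>2 * (2 ^ N * decay N x))" by (simp add: abs_le_iff)
    ultimately show ?thesis by (simp add: mult_ac)
  qed
  have "\<bar>second_diff f x y\<bar> \<le> (G * 2 ^ N + C0) * decay3 N x y * min 1 ((norm y)\<^sup>2)" for x y
  proof (cases "norm y \<le> 1")
    case True
    then have sq: "(norm y)\<^sup>2 \<le> 1" by (simp add: power_le_one)
    have "G * 2 ^ N * decay N x \<le> (G * 2 ^ N + C0) * decay3 N x y"
      using G C0 by (intro mult_mono) (auto simp: decay3_def intro!: add_nonneg_nonneg)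
    from mult_right_mono[OF this, of "(norm y)\<^sup>2"] near[OF True, of x] sq
    show ?thesis by (simp add: min_absorb2)
  next
    case False
    then have sq: "1 \<le> (norm y)\<^sup>2" by (simp add: one_le_power)
    have "\<bar>second_diff f x y\<bar> \<le> 2 * \<bar>f x\<bar> + \<bar>f (x + y)\<bar> + \<bar>f (x - y)\<bar>"
      unfolding second_diff_def by linarith
    also have "\<dots> \<le> C0 * decay3 N x y"
      using C0(2)[of x] C0(2)[of "x+y"] C0(2)[of "x-y"] by (simp add: decay3_def algebra_simps)
    also have "\<dots> \<le> (G * 2 ^ N + C0) * decay3 N x y"
      using G by (intro mult_right_mono) (auto simp: decay3_def intro!: add_nonneg_nonneg)
    finally show ?thesis using sq by (simp add: min_absorb1)
  qed
  then show ?thesis using G C0 by (intro exI[of _ "G * 2 ^ N + C0"]) auto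
qed

section \<open>Principal values\<close>

lemma tendsto_integral_off_shrinking_ball:
  fixes g :: "'a::euclidean_space \<Rightarrow> real"
  assumes g: "integrable lborel g"
  shows "((\<lambda>\<epsilon>. LINT h|lborel. indicator (- cball 0 \<epsilon>) h * g h) \<longlongrightarrow> integral\<^sup>L lborel g) (at_right 0)"
proof (rule tendsto_at_right_sequentially[of 0 1])
  fix S :: "nat \<Rightarrow> real"
  assume S: "\<And>n. 0 < S n" "S \<longlonglongrightarrow> 0"
  have [measurable]: "g \<in> borel_measurable borel" using g by auto
  have [measurable]: "- cball (0::'a) r \<in> sets borel" for r by simp
  show "(\<lambda>n. LINT h|lborel. indicator (- cball 0 (S n)) h * g h) \<longlonglongrightarrow> integral\<^sup>L lborel g"
  proof (rule integral_dominated_convergence[where w = "\<lambda>h. norm (g h)"])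
    show "AE h in lborel. (\<lambda>n. indicator (- cball 0 (S n)) h * g h) \<longlonglongrightarrow> g h"
      using AE_lborel_singleton[of "0::'a"]
    proof eventually_elim
      case (elim h)
      then have "\<forall>\<^sub>F n in sequentially. S n < norm h"
        using S(2) by (intro order_tendstoD(2)[of S 0]) auto
      then have "\<forall>\<^sub>F n in sequentially. indicator (- cball 0 (S n)) h * g h = g h"
        by eventually_elim simp
      then show ?case by (rule tendsto_eventually)
    qed
    show "AE h in lborel. norm (indicator (- cball 0 (S n)) h * g h) \<le> norm (g h)" for n
      by (auto simp: indicator_def)
  qed (use g in auto)
qed simp

lemma integrable_truncated_kernel:
  fixes g :: "real^'n \<Rightarrow> real"
  assumes \<alpha>: "0 < \<alpha>" "\<alpha> < 2" and \<epsilon>: "0 < \<epsilon>"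
    and [measurable]: "g \<in> borel_measurable borel" and B: "\<And>h. \<bar>g h\<bar> \<le> B"
  shows "integrable lborel (\<lambda>h. indicator (- cball 0 \<epsilon>) h * (g h * kernel \<alpha> h))"
proof (rule Bochner_Integration.integrable_bound)
  have [measurable]: "- cball (0::real^'n) r \<in> sets borel" for r by simp
  show "integrable lborel (\<lambda>h. (B / min 1 (\<epsilon>\<^sup>2)) * levy_kernel \<alpha> h :: real)"
    by (intro integrable_mult_right integrable_levy_kernel \<alpha>)
  show "(\<lambda>h. indicator (- cball 0 \<epsilon>) h * (g h * kernel \<alpha> h)) \<in> borel_measurable lborel"
    by measurable
  have "\<bar>g h\<bar> * kernel \<alpha> h \<le> (B / min 1 (\<epsilon>\<^sup>2)) * levy_kernel \<alpha> h" if h: "\<epsilon> < norm h" for h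
  proof -
    have "\<epsilon>\<^sup>2 \<le> (norm h)\<^sup>2" using h \<epsilon> by (intro power_mono) auto
    then have m: "min 1 (\<epsilon>\<^sup>2) \<le> min 1 ((norm h)\<^sup>2)" by auto
    have p: "0 < min 1 (\<epsilon>\<^sup>2)" using \<epsilon> by simp
    have "B * 1 \<le> B * (min 1 ((norm h)\<^sup>2) / min 1 (\<epsilon>\<^sup>2))"
      using m p B[of h] by (intro mult_left_mono) (auto simp: le_divide_eq)
    then have "\<bar>g h\<bar> \<le> B / min 1 (\<epsilon>\<^sup>2) * min 1 ((norm h)\<^sup>2)"
      using B[of h] by (simp add: field_simps)
    from mult_right_mono[OF this kernel_nonneg[of \<alpha> h]]
    show ?thesis by (simp add: levy_kernel_def mult.assoc)
  qed
  moreover have "0 \<le> B" using B[of 0] by (rule order_trans[OF abs_ge_zero])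
  moreover have "0 < min 1 (\<epsilon>\<^sup>2)" using \<epsilon> by simp
  ultimately show "AE h in lborel. norm (indicator (- cball 0 \<epsilon>) h * (g h * kernel \<alpha> h))
      \<le> norm ((B / min 1 (\<epsilon>\<^sup>2)) * levy_kernel \<alpha> h)"
    by (intro always_eventually) (auto simp: indicator_def abs_mult)
qed

definition truncated_pv :: "real \<Rightarrow> (real^'n \<Rightarrow> real) \<Rightarrow> real^'n \<Rightarrow> real \<Rightarrow> real" where
  "truncated_pv \<alpha> f x \<epsilon> = (LINT h|lborel. indicator (- cball 0 \<epsilon>) h * ((f x - f (x + h)) * kernel \<alpha> h))"

lemma pv_integral_eq_Lim:
  fixes f :: "real^'n \<Rightarrow> real"
  assumes [measurable]: "f \<in> borel_measurable borel"
  shows "pv_integral \<alpha> f x = Lim (at_right 0) (truncated_pv \<alpha> f x)"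
proof -
  have [measurable]: "- cball (z::real^'n) r \<in> sets borel" for z r by simp
  have "(LINT y:- cball x \<epsilon>|lborel. (f x - f y) / norm (x - y) powr (real CARD('n) + \<alpha>))
      = truncated_pv \<alpha> f x \<epsilon>" for \<epsilon>
  proof -
    let ?F = "\<lambda>y. indicator (- cball x \<epsilon>) y *\<^sub>R ((f x - f y) / norm (x - y) powr (real CARD('n) + \<alpha>))"
    have "integral\<^sup>L lborel ?F = (LINT h|lborel. ?F (x + h))"
      by (rule integral_lborel_invariant[OF distr_lborel_translation, symmetric]) measurable
    also have "\<dots> = truncated_pv \<alpha> f x \<epsilon>"
      unfolding truncated_pv_def
      by (intro Bochner_Integration.integral_cong)
        (auto simp: indicator_def kernel_def powr_minus_divide dist_norm minus_divide_left
          simp del: powr_minus minus_add_distrib)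
    finally show ?thesis by (simp only: set_lebesgue_integral_def)
  qed
  then show ?thesis unfolding pv_integral_def by simp
qed

lemma truncated_pv_reflect:
  fixes f :: "real^'n \<Rightarrow> real"
  assumes [measurable]: "f \<in> borel_measurable borel"
  shows "truncated_pv \<alpha> f x \<epsilon> = (LINT h|lborel. indicator (- cball 0 \<epsilon>) h * ((f x - f (x - h)) * kernel \<alpha> h))"
proof -
  have [measurable]: "- cball (z::real^'n) r \<in> sets borel" for z r by simp
  let ?F = "\<lambda>h. indicator (- cball 0 \<epsilon>) h * ((f x - f (x + h)) * kernel \<alpha> h)"
  have "truncated_pv \<alpha> f x \<epsilon> = (LINT h|lborel. ?F (- h))"
    unfolding truncated_pv_def
    by (rule integral_lborel_invariant[OF distr_lborel_uminus, symmetric]) measurable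
  also have "\<dots> = (LINT h|lborel. indicator (- cball 0 \<epsilon>) h * ((f x - f (x - h)) * kernel \<alpha> h))"
    by (intro Bochner_Integration.integral_cong) (auto simp: indicator_def)
  finally show ?thesis .
qed

lemma schwartz_bounded:
  assumes "schwartz f"
  obtains B where "0 \<le> B" "\<And>x. \<bar>f x\<bar> \<le> B"
  using schwartz_decay[OF assms, of "[]" 0] by (auto simp: decay_def)

lemma decay3_le: "decay3 N x y \<le> 4"
  unfolding decay3_def using decay_le_1[of N x] decay_le_1[of N "x + y"] decay_le_1[of N "x - y"]
  by simp

lemma integrable_second_diff:
  fixes f :: "real^'n \<Rightarrow> real"
  assumes \<alpha>: "0 < \<alpha>" "\<alpha> < 2" and f: "schwartz f"
  shows "integrable lborel (\<lambda>h. second_diff f x h * kernel \<alpha> h)"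
proof -
  obtain C where C: "0 \<le> C" "\<And>x y. \<bar>second_diff f x y\<bar> \<le> C * decay3 0 x y * min 1 ((norm y)\<^sup>2)"
    using second_diff_bound[OF f, of 0] by auto
  have [measurable]: "f \<in> borel_measurable borel" using f by (rule measurable_schwartz)
  show ?thesis
  proof (rule Bochner_Integration.integrable_bound)
    show "integrable lborel (\<lambda>h. (C * 4) * levy_kernel \<alpha> h :: real)"
      by (intro integrable_mult_right integrable_levy_kernel \<alpha>)
    have "\<bar>second_diff f x h\<bar> * kernel \<alpha> h \<le> (C * 4) * levy_kernel \<alpha> h" for h
    proof -
      have "\<bar>second_diff f x h\<bar> \<le> C * 4 * min 1 ((norm h)\<^sup>2)"
        by (rule order_trans[OF C(2)]) (intro mult_right_mono mult_left_mono decay3_le C, simp)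
      from mult_right_mono[OF this kernel_nonneg[of \<alpha> h]] show ?thesis
        by (simp add: levy_kernel_def mult.assoc)
    qed
    then show "AE h in lborel. norm (second_diff f x h * kernel \<alpha> h) \<le> norm ((C * 4) * levy_kernel \<alpha> h)"
      using C(1) by (intro always_eventually) (simp add: abs_mult)
  qed (simp add: second_diff_def)
qed

lemma tendsto_truncated_pv:
  fixes f :: "real^'n \<Rightarrow> real"
  assumes \<alpha>: "0 < \<alpha>" "\<alpha> < 2" and f: "schwartz f"
  shows "(truncated_pv \<alpha> f x \<longlongrightarrow> (1/2) * (LINT h|lborel. second_diff f x h * kernel \<alpha> h)) (at_right 0)"
proof -
  obtain B where B: "0 \<le> B" "\<And>x. \<bar>f x\<bar> \<le> B" using schwartz_bounded[OF f] by blast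
  have [measurable]: "f \<in> borel_measurable borel" using f by (rule measurable_schwartz)
  have bd: "\<bar>f x - f z\<bar> \<le> 2 * B" for z using B(2)[of x] B(2)[of z] by (simp add: abs_le_iff)
  have "truncated_pv \<alpha> f x \<epsilon>
      = (1/2) * (LINT h|lborel. indicator (- cball 0 \<epsilon>) h * (second_diff f x h * kernel \<alpha> h))"
    if "0 < \<epsilon>" for \<epsilon>
  proof -
    have "2 * truncated_pv \<alpha> f x \<epsilon>
        = (LINT h|lborel. indicator (- cball 0 \<epsilon>) h * ((f x - f (x + h)) * kernel \<alpha> h))
        + (LINT h|lborel. indicator (- cball 0 \<epsilon>) h * ((f x - f (x - h)) * kernel \<alpha> h))"
      using truncated_pv_reflect[of f \<alpha> x \<epsilon>] by (simp add: truncated_pv_def)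
    also have "\<dots> = (LINT h|lborel. indicator (- cball 0 \<epsilon>) h * ((f x - f (x + h)) * kernel \<alpha> h)
        + indicator (- cball 0 \<epsilon>) h * ((f x - f (x - h)) * kernel \<alpha> h))"
      by (intro Bochner_Integration.integral_add[symmetric] integrable_truncated_kernel[where B = "2 * B"] \<alpha> that bd)
        measurable
    also have "\<dots> = (LINT h|lborel. indicator (- cball 0 \<epsilon>) h * (second_diff f x h * kernel \<alpha> h))"
      by (intro Bochner_Integration.integral_cong) (auto simp: second_diff_def algebra_simps)
    finally show ?thesis by simp
  qed
  then have "\<forall>\<^sub>F \<epsilon> in at_right 0. (1/2) * (LINT h|lborel. indicator (- cball 0 \<epsilon>) h * (second_diff f x h * kernel \<alpha> h))
      = truncated_pv \<alpha> f x \<epsilon>"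
    by (auto simp: eventually_at_right_less intro: eventually_mono[OF eventually_at_right_less[of 0]])
  then show ?thesis
    by (rule Lim_transform_eventually[rotated])
      (intro tendsto_intros tendsto_integral_off_shrinking_ball integrable_second_diff \<alpha> f)
qed

text \<open>The truncation is symmetric, so the truncated integral equals its average with its reflection, half the
truncated integral of the second difference. That integrand is absolutely integrable, and the
truncation can be removed.\<close>

lemma pv_integral_schwartz:
  fixes f :: "real^'n \<Rightarrow> real"
  assumes "0 < \<alpha>" "\<alpha> < 2" and f: "schwartz f"
  shows "pv_integral \<alpha> f x = (1/2) * (LINT h|lborel. second_diff f x h * kernel \<alpha> h)"
  using tendsto_Lim[OF _ tendsto_truncated_pv[OF assms]] measurable_schwartz[OF f]
  by (simp add: pv_integral_eq_Lim)

text \<open>The carre du champ of the operator, up to its normalizing constant.\<close>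

definition jump_energy :: "real \<Rightarrow> (real^'n \<Rightarrow> real) \<Rightarrow> real^'n \<Rightarrow> real" where
  "jump_energy \<alpha> f x = (LINT h|lborel. (f x - f (x + h))\<^sup>2 * kernel \<alpha> h)"

lemma integrable_jump_energy:
  fixes f :: "real^'n \<Rightarrow> real"
  assumes \<alpha>: "0 < \<alpha>" "\<alpha> < 2" and f: "schwartz f"
  shows "integrable lborel (\<lambda>h. (f x - f (x + h))\<^sup>2 * kernel \<alpha> h)"
proof -
  obtain B where B: "0 \<le> B" "\<And>x. \<bar>f x\<bar> \<le> B" using schwartz_bounded[OF f] by blast
  obtain L where L: "0 \<le> L" "\<And>x y. \<bar>f (x + y) - f x\<bar> \<le> L * norm y"
    using schwartz_lipschitz[OF f] by auto
  have [measurable]: "f \<in> borel_measurable borel" using f by (rule measurable_schwartz)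
  show ?thesis
  proof (rule Bochner_Integration.integrable_bound)
    show "integrable lborel (\<lambda>h. ((2 * B)\<^sup>2 + L\<^sup>2) * levy_kernel \<alpha> h :: real)"
      by (intro integrable_mult_right integrable_levy_kernel \<alpha>)
    have "(f x - f (x + h))\<^sup>2 * kernel \<alpha> h \<le> ((2 * B)\<^sup>2 + L\<^sup>2) * levy_kernel \<alpha> h" for h
    proof -
      have "\<bar>f x - f (x + h)\<bar> \<le> 2 * B" using B(2)[of x] B(2)[of "x + h"] by (simp add: abs_le_iff)
      then have 1: "(f x - f (x + h))\<^sup>2 \<le> (2 * B)\<^sup>2" using B(1) by (intro abs_le_square_iff[THEN iffD1]) simp
      have "\<bar>f x - f (x + h)\<bar> \<le> L * norm h" using L(2)[of x h] by (simp add: abs_minus_commute)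
      then have 2: "(f x - f (x + h))\<^sup>2 \<le> (L * norm h)\<^sup>2" using L(1) by (intro abs_le_square_iff[THEN iffD1]) simp
      have "(f x - f (x + h))\<^sup>2 \<le> ((2 * B)\<^sup>2 + L\<^sup>2) * min 1 ((norm h)\<^sup>2)"
      proof (cases "(norm h)\<^sup>2 \<le> 1")
        case True
        have "(f x - f (x + h))\<^sup>2 \<le> L\<^sup>2 * (norm h)\<^sup>2" using 2 by (simp add: power_mult_distrib)
        also have "\<dots> \<le> ((2 * B)\<^sup>2 + L\<^sup>2) * (norm h)\<^sup>2" by (intro mult_right_mono) auto
        finally show ?thesis using True by (simp add: min_absorb2)
      next
        case False
        then show ?thesis using 1 by (simp add: min_absorb1 add_increasing2)
      qed
      from mult_right_mono[OF this kernel_nonneg[of \<alpha> h]] show ?thesis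
        by (simp add: levy_kernel_def mult.assoc)
    qed
    then show "AE h in lborel. norm ((f x - f (x + h))\<^sup>2 * kernel \<alpha> h) \<le> norm (((2 * B)\<^sup>2 + L\<^sup>2) * levy_kernel \<alpha> h)"
      by (intro always_eventually allI) (simp add: abs_mult)
  qed simp
qed

text \<open>The identity \<open>2 a (a - b) - (a\<^sup>2 - b\<^sup>2) = (a - b)\<^sup>2\<close> holds under the truncated integrals. As the
truncations for \<open>f\<close> and for the jump energy converge, those for \<open>f\<^sup>2\<close> converge as well, to the
value given by the identity.\<close>

lemma carre_du_champ:
  fixes f :: "real^'n \<Rightarrow> real"
  assumes \<alpha>: "0 < \<alpha>" "\<alpha> < 2" and f: "schwartz f"
  shows "2 * f x * pv_integral \<alpha> f x - pv_integral \<alpha> (\<lambda>y. (f y)\<^sup>2) x = jump_energy \<alpha> f x"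
proof -
  obtain B where B: "0 \<le> B" "\<And>x. \<bar>f x\<bar> \<le> B" using schwartz_bounded[OF f] by blast
  have [measurable]: "f \<in> borel_measurable borel" using f by (rule measurable_schwartz)
  have [measurable]: "- cball (z::real^'n) r \<in> sets borel" for z r by simp
  have bd: "\<bar>f x - f z\<bar> \<le> 2 * B" for z using B(2)[of x] B(2)[of z] by (simp add: abs_le_iff)
  have bd2: "\<bar>(f x - f z)\<^sup>2\<bar> \<le> (2 * B)\<^sup>2" for z
    using bd[of z] B(1) abs_le_square_iff[of "f x - f z" "2 * B"] by simp
  let ?E = "\<lambda>\<epsilon>. LINT h|lborel. indicator (- cball 0 \<epsilon>) h * ((f x - f (x + h))\<^sup>2 * kernel \<alpha> h)"
  have "truncated_pv \<alpha> (\<lambda>y. (f y)\<^sup>2) x \<epsilon> = 2 * f x * truncated_pv \<alpha> f x \<epsilon> - ?E \<epsilon>" if "0 < \<epsilon>" for \<epsilon>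
  proof -
    have "truncated_pv \<alpha> (\<lambda>y. (f y)\<^sup>2) x \<epsilon>
        = (LINT h|lborel. 2 * f x * (indicator (- cball 0 \<epsilon>) h * ((f x - f (x + h)) * kernel \<alpha> h))
            - indicator (- cball 0 \<epsilon>) h * ((f x - f (x + h))\<^sup>2 * kernel \<alpha> h))"
      unfolding truncated_pv_def
      by (intro Bochner_Integration.integral_cong) (auto simp: power2_eq_square algebra_simps)
    also have "\<dots> = (LINT h|lborel. 2 * f x * (indicator (- cball 0 \<epsilon>) h * ((f x - f (x + h)) * kernel \<alpha> h))) - ?E \<epsilon>"
      by (intro Bochner_Integration.integral_diff integrable_mult_right
          integrable_truncated_kernel[where B = "2 * B"] integrable_truncated_kernel[where B = "(2 * B)\<^sup>2"] \<alpha> that bd bd2)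
        measurable
    finally show ?thesis unfolding truncated_pv_def by simp
  qed
  then have ev: "\<forall>\<^sub>F \<epsilon> in at_right 0. 2 * f x * truncated_pv \<alpha> f x \<epsilon> - ?E \<epsilon> = truncated_pv \<alpha> (\<lambda>y. (f y)\<^sup>2) x \<epsilon>"
    by (auto intro: eventually_mono[OF eventually_at_right_less[of 0]])
  have "(truncated_pv \<alpha> (\<lambda>y. (f y)\<^sup>2) x \<longlongrightarrow> 2 * f x * pv_integral \<alpha> f x - jump_energy \<alpha> f x) (at_right 0)"
    unfolding pv_integral_schwartz[OF assms] jump_energy_def
    by (rule Lim_transform_eventually[OF _ ev])
      (intro tendsto_diff tendsto_mult tendsto_const tendsto_truncated_pv tendsto_integral_off_shrinking_ball
        integrable_jump_energy \<alpha> f)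
  then have "pv_integral \<alpha> (\<lambda>y. (f y)\<^sup>2) x = 2 * f x * pv_integral \<alpha> f x - jump_energy \<alpha> f x"
    by (subst pv_integral_eq_Lim) (auto intro!: tendsto_Lim)
  then show ?thesis by simp
qed

section \<open>Fourier transform of the singular integral\<close>

lemma integrable_schwartz:
  fixes f :: "real^'n \<Rightarrow> real"
  assumes f: "schwartz f"
  shows "integrable lborel f"
proof -
  obtain C where C: "0 \<le> C" "\<And>x. \<bar>f x\<bar> \<le> C * decay (CARD('n) + 1) x"
    using schwartz_decay[OF f, of "[]" "CARD('n) + 1"] by auto
  have [measurable]: "f \<in> borel_measurable borel" using f by (rule measurable_schwartz)
  show ?thesis
    by (rule Bochner_Integration.integrable_bound[of _ "\<lambda>x. C * decay (CARD('n) + 1) x"])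
      (use C in \<open>auto intro!: integrable_mult_right integrable_decay simp: abs_mult\<close>)
qed

lemma continuous_cis_inner: "continuous_on UNIV (\<lambda>x::real^'n. cis (- (\<xi> \<bullet> x)))"
  by (intro continuous_intros)

lemma measurable_cis_inner [measurable]:
  "(\<lambda>x::real^'n. cis (- (\<xi> \<bullet> x))) \<in> borel_measurable borel"
  by (intro borel_measurable_continuous_onI continuous_cis_inner)

lemma integrable_cis_mult:
  fixes f :: "real^'n \<Rightarrow> real"
  assumes "integrable lborel f"
  shows "integrable lborel (\<lambda>x. cis (- (\<xi> \<bullet> x)) * complex_of_real (f x))"
proof (rule Bochner_Integration.integrable_bound[OF assms])
  have [measurable]: "f \<in> borel_measurable borel" using assms by auto
  show "(\<lambda>x. cis (- (\<xi> \<bullet> x)) * complex_of_real (f x)) \<in> borel_measurable lborel" by measurable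
qed (simp add: norm_mult)

lemma
  fixes f :: "real^'n \<Rightarrow> real"
  assumes f: "integrable lborel f"
  shows integrable_translate: "integrable lborel (\<lambda>x. f (x + y))"
    and fourier_translate: "fourier (\<lambda>x. f (x + y)) \<xi> = cis (\<xi> \<bullet> y) * fourier f \<xi>"
proof -
  have [measurable]: "f \<in> borel_measurable borel" using f by auto
  show "integrable lborel (\<lambda>x. f (x + y))"
    using integrable_lborel_invariant[OF distr_lborel_translation[of y], of f] f
    by (simp add: add.commute)
  let ?g = "\<lambda>x. cis (\<xi> \<bullet> y) * (cis (- (\<xi> \<bullet> x)) * complex_of_real (f x))"
  have "fourier (\<lambda>x. f (x + y)) \<xi> = (LINT x|lborel. ?g (y + x))"
    unfolding fourier_def
    by (intro Bochner_Integration.integral_cong)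
      (simp_all add: cis_mult mult.assoc[symmetric] inner_add_right add.commute)
  also have "\<dots> = integral\<^sup>L lborel ?g"
    by (rule integral_lborel_invariant[OF distr_lborel_translation]) measurable
  finally show "fourier (\<lambda>x. f (x + y)) \<xi> = cis (\<xi> \<bullet> y) * fourier f \<xi>"
    by (simp add: fourier_def)
qed

lemma fourier_second_diff:
  fixes f :: "real^'n \<Rightarrow> real"
  assumes f: "integrable lborel f"
  shows "fourier (\<lambda>x. second_diff f x y) \<xi> = complex_of_real (2 * (1 - cos (\<xi> \<bullet> y))) * fourier f \<xi>"
proof -
  let ?c = "\<lambda>x. cis (- (\<xi> \<bullet> x))"
  note I = integrable_cis_mult[OF f, of \<xi>] integrable_cis_mult[OF integrable_translate[OF f], of \<xi>]
  have "fourier (\<lambda>x. second_diff f x y) \<xi> = (LINT x|lborel. 2 * (?c x * complex_of_real (f x))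
      - ?c x * complex_of_real (f (x + y)) - ?c x * complex_of_real (f (x + - y)))"
    unfolding fourier_def second_diff_def
    by (intro Bochner_Integration.integral_cong) (simp_all add: algebra_simps)
  also have "\<dots> = (LINT x|lborel. 2 * (?c x * complex_of_real (f x)))
      - fourier (\<lambda>x. f (x + y)) \<xi> - fourier (\<lambda>x. f (x + - y)) \<xi>"
    unfolding fourier_def
    by (subst Bochner_Integration.integral_diff | intro Bochner_Integration.integrable_diff integrable_mult_right I | simp only:)+
  also have "\<dots> = 2 * fourier f \<xi> - cis (\<xi> \<bullet> y) * fourier f \<xi> - cis (- (\<xi> \<bullet> y)) * fourier f \<xi>"
    using fourier_translate[OF f, of y \<xi>] fourier_translate[OF f, of "- y" \<xi>] by (simp add: fourier_def)
  also have "\<dots> = complex_of_real (2 * (1 - cos (\<xi> \<bullet> y))) * fourier f \<xi>"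
    by (simp add: complex_eq_iff algebra_simps)
  finally show ?thesis .
qed

text \<open>The joint majorant that justifies exchanging the integral over the jump \<open>y\<close> with the Fourier integral
over \<open>x\<close>.\<close>

lemma integrable_decay3_levy_kernel:
  assumes \<alpha>: "0 < \<alpha>" "\<alpha> < 2" and N: "CARD('n::finite) < N"
  shows "integrable (lborel \<Otimes>\<^sub>M lborel) (\<lambda>(y, x :: real^'n). decay3 N x y * levy_kernel \<alpha> y)"
proof (rule lborel_pair.Fubini_integrable)
  let ?b = "decay N :: real^'n \<Rightarrow> real"
  note b = integrable_decay[OF N]
  have I: "integrable lborel (\<lambda>x. 2 * ?b x)" "integrable lborel (\<lambda>x. ?b (x + y))" "integrable lborel (\<lambda>x. ?b (x - y))" for y
    using integrable_translate[OF b, of y] integrable_translate[OF b, of "- y"] b by simp_all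
  have tr: "(LINT x|lborel. ?b (x + y)) = integral\<^sup>L lborel ?b" for y
    using integral_lborel_invariant[OF distr_lborel_translation[of y], of ?b] by (simp add: add.commute)
  have i3: "integrable lborel (\<lambda>x. decay3 N x y)" for y :: "real^'n"
    unfolding decay3_def by (intro Bochner_Integration.integrable_add I)
  have l3: "(LINT x|lborel. decay3 N x y) = 4 * integral\<^sup>L lborel ?b" for y :: "real^'n"
    unfolding decay3_def using tr[of y] tr[of "- y"]
    by (simp add: Bochner_Integration.integral_add[OF Bochner_Integration.integrable_add[OF I(1,2)] I(3)]
        Bochner_Integration.integral_add[OF I(1,2)])
  show "(\<lambda>(y, x :: real^'n). decay3 N x y * levy_kernel \<alpha> y) \<in> borel_measurable (lborel \<Otimes>\<^sub>M lborel)"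
    unfolding decay3_def by measurable
  have nn: "0 \<le> decay3 N x y" for x y :: "real^'n" by (simp add: decay3_def)
  have "(LINT x|lborel. norm ((\<lambda>(y, x :: real^'n). decay3 N x y * levy_kernel \<alpha> y) (y, x)))
      = 4 * integral\<^sup>L lborel ?b * levy_kernel \<alpha> y" for y
    using nn by (simp add: abs_mult l3)
  then show "integrable lborel (\<lambda>y. LINT x|lborel. norm ((\<lambda>(y, x :: real^'n). decay3 N x y * levy_kernel \<alpha> y) (y, x)))"
    by (simp only:) (intro integrable_mult_right integrable_levy_kernel \<alpha>)
  show "AE y in lborel. integrable lborel (\<lambda>x. (\<lambda>(y, x :: real^'n). decay3 N x y * levy_kernel \<alpha> y) (y, x))"
    using i3 by (intro always_eventually) simp
qed

text \<open>Translating a function by \<open>y\<close> multiplies its transform by \<open>cis (\<xi> \<bullet> y)\<close>, so for fixed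
\<open>y\<close> the second difference contributes the factor \<open>2 (1 - cos (\<xi> \<bullet> y))\<close>; integrating over
\<open>y\<close> gives the symbol.\<close>

lemma fourier_pv_integral:
  fixes f :: "real^'n \<Rightarrow> real"
  assumes \<alpha>: "0 < \<alpha>" "\<alpha> < 2" and f: "schwartz f"
  shows "fourier (\<lambda>x. k * pv_integral \<alpha> f x) \<xi> = complex_of_real (k * symbol \<alpha> \<xi>) * fourier f \<xi>"
proof -
  define N where "N = CARD('n) + 1"
  obtain C where C: "0 \<le> C" "\<And>x y. \<bar>second_diff f x y\<bar> \<le> C * decay3 N x y * min 1 ((norm y)\<^sup>2)"
    using second_diff_bound[OF f, of N] by auto
  have [measurable]: "f \<in> borel_measurable borel" using f by (rule measurable_schwartz)
  let ?c = "\<lambda>x. cis (- (\<xi> \<bullet> x))"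
  define F where "F y x = ?c x * complex_of_real (second_diff f x y * kernel \<alpha> y)" for y x
  have F: "integrable (lborel \<Otimes>\<^sub>M lborel) (case_prod F)"
  proof (rule Bochner_Integration.integrable_bound)
    show "integrable (lborel \<Otimes>\<^sub>M lborel) (\<lambda>p. C * (\<lambda>(y, x :: real^'n). decay3 N x y * levy_kernel \<alpha> y) p)"
      by (intro integrable_mult_right integrable_decay3_levy_kernel \<alpha>) (simp add: N_def)
    show "case_prod F \<in> borel_measurable (lborel \<Otimes>\<^sub>M lborel)"
      unfolding F_def second_diff_def by measurable
    have "\<bar>second_diff f x y\<bar> * kernel \<alpha> y \<le> C * (decay3 N x y * levy_kernel \<alpha> y)" for x y
      using mult_right_mono[OF C(2)[of x y] kernel_nonneg[of \<alpha> y]]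
      by (simp add: levy_kernel_def mult_ac)
    then show "AE p in lborel \<Otimes>\<^sub>M lborel. norm (case_prod F p)
        \<le> norm (C * (\<lambda>(y, x :: real^'n). decay3 N x y * levy_kernel \<alpha> y) p)"
      by (intro always_eventually)
        (auto simp: F_def norm_mult split: prod.split intro: order_trans[OF _ abs_ge_self])
  qed
  have "fourier (\<lambda>x. k * pv_integral \<alpha> f x) \<xi>
      = (LINT x|lborel. complex_of_real (k / 2) * (LINT y|lborel. F y x))"
    unfolding fourier_def F_def pv_integral_schwartz[OF assms]
    by (intro Bochner_Integration.integral_cong) (simp_all del: of_real_mult, simp)
  also have "\<dots> = complex_of_real (k / 2) * (LINT x|lborel. LINT y|lborel. F y x)"
    by (rule integral_mult_right_zero)
  also have "(LINT x|lborel. LINT y|lborel. F y x) = (LINT y|lborel. LINT x|lborel. F y x)"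
    by (rule lborel_pair.Fubini_integral[OF F])
  also have "\<dots> = (LINT y|lborel. complex_of_real ((1 - cos (\<xi> \<bullet> y)) * kernel \<alpha> y) * (2 * fourier f \<xi>))"
  proof (intro Bochner_Integration.integral_cong refl)
    fix y
    have "(LINT x|lborel. F y x) = complex_of_real (kernel \<alpha> y) * fourier (\<lambda>x. second_diff f x y) \<xi>"
      unfolding fourier_def F_def integral_mult_right_zero[symmetric]
      by (intro Bochner_Integration.integral_cong) simp_all
    then show "(LINT x|lborel. F y x) = complex_of_real ((1 - cos (\<xi> \<bullet> y)) * kernel \<alpha> y) * (2 * fourier f \<xi>)"
      by (simp add: fourier_second_diff[OF integrable_schwartz[OF f]])
  qed
  also have "\<dots> = complex_of_real (symbol \<alpha> \<xi>) * (2 * fourier f \<xi>)"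
    unfolding symbol_def by (simp only: integral_mult_left_zero integral_complex_of_real)
  finally show ?thesis by simp
qed

section \<open>The Gaussian is a Schwartz function\<close>

lemma real_polynomial_has_derivative:
  fixes P :: "'a::real_normed_vector \<Rightarrow> real"
  assumes "real_polynomial_function P"
  shows "\<exists>D. (\<forall>v. real_polynomial_function (\<lambda>x. D x v)) \<and> (\<forall>x. (P has_derivative D x) (at x))"
  using assms
proof induction
  case (linear f)
  then show ?case
    by (intro exI[of _ "\<lambda>x. f"]) (auto intro: bounded_linear_imp_has_derivative)
next
  case (const c)
  show ?case by (intro exI[of _ "\<lambda>x v. 0"]) auto
next
  case (add f g)
  then obtain D E where "\<forall>v. real_polynomial_function (\<lambda>x. D x v)" "\<forall>x. (f has_derivative D x) (at x)"
    "\<forall>v. real_polynomial_function (\<lambda>x. E x v)" "\<forall>x. (g has_derivative E x) (at x)" by blast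
  then show ?case by (intro exI[of _ "\<lambda>x v. D x v + E x v"]) (auto intro: has_derivative_add)
next
  case (mult f g)
  then obtain D E where "\<forall>v. real_polynomial_function (\<lambda>x. D x v)" "\<forall>x. (f has_derivative D x) (at x)"
    "\<forall>v. real_polynomial_function (\<lambda>x. E x v)" "\<forall>x. (g has_derivative E x) (at x)" by blast
  moreover from this mult.hyps have "real_polynomial_function (\<lambda>x. f x * E x v + D x v * g x)" for v
    by (intro real_polynomial_function.intros(3) real_polynomial_function.intros(4)[of f]
        real_polynomial_function.intros(4)[of _ g]) auto
  ultimately show ?case
    by (intro exI[of _ "\<lambda>x v. f x * E x v + D x v * g x"]) (auto intro: has_derivative_mult)
qed

lemma real_polynomial_growth:
  fixes P :: "'a::real_normed_vector \<Rightarrow> real"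
  assumes "real_polynomial_function P"
  shows "\<exists>C k. 0 \<le> C \<and> (\<forall>x. \<bar>P x\<bar> \<le> C * (1 + norm x) ^ k)"
  using assms
proof induction
  case (linear f)
  then obtain K where "0 < K" "\<And>x. norm (f x) \<le> norm x * K"
    using bounded_linear.pos_bounded by blast
  then have "\<bar>f x\<bar> \<le> K * (1 + norm x) ^ 1" for x
    by (simp add: algebra_simps) (smt (verit))
  then show ?case using \<open>0 < K\<close> by (intro exI[of _ K] exI[of _ 1]) auto
next
  case (const c)
  show ?case by (intro exI[of _ "\<bar>c\<bar>"] exI[of _ 0]) auto
next
  case (add f g)
  then obtain C k D l where *: "0 \<le> C" "\<And>x. \<bar>f x\<bar> \<le> C * (1 + norm x) ^ k"
    "0 \<le> D" "\<And>x. \<bar>g x\<bar> \<le> D * (1 + norm x) ^ l" by blast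
  have "\<bar>f x + g x\<bar> \<le> (C + D) * (1 + norm x) ^ (k + l)" for x
  proof -
    have "C * (1 + norm x) ^ k \<le> C * (1 + norm x) ^ (k + l)"
      "D * (1 + norm x) ^ l \<le> D * (1 + norm x) ^ (k + l)"
      using * by (auto intro!: mult_left_mono power_increasing)
    then show ?thesis using *(2)[of x] *(4)[of x] unfolding distrib_right by linarith
  qed
  then show ?case using * by (intro exI[of _ "C + D"] exI[of _ "k + l"]) auto
next
  case (mult f g)
  then obtain C k D l where *: "0 \<le> C" "\<And>x. \<bar>f x\<bar> \<le> C * (1 + norm x) ^ k"
    "0 \<le> D" "\<And>x. \<bar>g x\<bar> \<le> D * (1 + norm x) ^ l" by blast
  have "\<bar>f x * g x\<bar> \<le> (C * D) * (1 + norm x) ^ (k + l)" for x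
    using mult_mono[OF *(2)[of x] *(4)[of x]] * by (simp add: abs_mult power_add mult_ac)
  then show ?case using * by (intro exI[of _ "C * D"] exI[of _ "k + l"]) auto
qed

lemma power_le_fact_exp: "0 \<le> t \<Longrightarrow> t ^ k \<le> fact k * exp t" for t :: real
proof -
  assume t: "0 \<le> t"
  have "(\<Sum>n\<in>{k}. t ^ n /\<^sub>R fact n) \<le> (\<Sum>n. t ^ n /\<^sub>R fact n)"
    using t by (intro sum_le_suminf summable_exp_generic) auto
  then show ?thesis by (simp add: exp_def field_simps)
qed

definition gaussian :: "real^'n \<Rightarrow> real" where
  "gaussian x = exp (- (x \<bullet> x))"

lemma gaussian_times_power_le: "(1 + norm x) ^ k * gaussian x \<le> fact k * exp 2"
proof -
  \<comment> \<open>Complete the square; the exponent \<open>1 + |x| - |x|\<^sup>2\<close> is then at most \<open>2\<close>.\<close>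
  have "norm x - x \<bullet> x \<le> 1"
    using zero_le_power2[of "norm x - 1/2"]
    by (simp add: power2_eq_square algebra_simps flip: power2_norm_eq_inner)
  have "(1 + norm x) ^ k * gaussian x \<le> fact k * exp (1 + norm x) * gaussian x"
    by (intro mult_right_mono power_le_fact_exp) (auto simp: gaussian_def)
  also have "\<dots> = fact k * exp (1 + norm x - x \<bullet> x)"
    by (simp add: gaussian_def exp_diff exp_minus field_simps)
  also have "\<dots> \<le> fact k * exp 2" using \<open>norm x - x \<bullet> x \<le> 1\<close> by simp
  finally show ?thesis .
qed

lemma gaussian_has_derivative:
  "(gaussian has_derivative (\<lambda>v. - 2 * (x \<bullet> v) * gaussian x)) (at x)"
  unfolding gaussian_def
  by (auto intro!: derivative_eq_intros simp: inner_commute algebra_simps)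

lemma polynomial_times_gaussian_has_derivative:
  assumes "real_polynomial_function P"
  shows "\<exists>D. (\<forall>v. real_polynomial_function (\<lambda>x. D x v)) \<and>
    (\<forall>x. ((\<lambda>x. P x * gaussian x) has_derivative (\<lambda>v. D x v * gaussian x)) (at x))"
proof -
  obtain D where D: "\<And>v. real_polynomial_function (\<lambda>x. D x v)" "\<And>x. (P has_derivative D x) (at x)"
    using real_polynomial_has_derivative[OF assms] by blast
  have "real_polynomial_function (\<lambda>x. (- 2) * (x \<bullet> v))" for v :: "real^'a"
    by (intro real_polynomial_function.intros(4)[OF real_polynomial_function.intros(2)
          real_polynomial_function.intros(1)] bounded_linear_inner_left)
  then have "real_polynomial_function (\<lambda>x. P x * (- 2 * (x \<bullet> v)) + D x v)" for v
    by (intro real_polynomial_function.intros(3) real_polynomial_function.intros(4)[OF assms] D)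
  moreover have "((\<lambda>x. P x * gaussian x) has_derivative (\<lambda>v. (P x * (- 2 * (x \<bullet> v)) + D x v) * gaussian x)) (at x)" for x
    using has_derivative_mult[OF D(2)[of x] gaussian_has_derivative[of x]]
    by (simp add: algebra_simps)
  ultimately show ?thesis
    by (intro exI[of _ "\<lambda>x v. P x * (- 2 * (x \<bullet> v)) + D x v"]) blast
qed

text \<open>The products of a polynomial with the Gaussian are closed under partial derivatives.\<close>

lemma partials_gaussian:
  "\<exists>P. real_polynomial_function P \<and> partials is gaussian = (\<lambda>x. P x * gaussian x)"
proof (induction "is")
  case Nil
  show ?case by (intro exI[of _ "\<lambda>_. 1"]) (auto simp: fun_eq_iff)
next
  case (Cons i "is")
  then obtain P where P: "real_polynomial_function P" "partials is gaussian = (\<lambda>x. P x * gaussian x)" by blast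
  obtain D where D: "\<And>v. real_polynomial_function (\<lambda>x. D x v)"
    "\<And>x. ((\<lambda>x. P x * gaussian x) has_derivative (\<lambda>v. D x v * gaussian x)) (at x)"
    using polynomial_times_gaussian_has_derivative[OF P(1)] by blast
  have "partials (i # is) gaussian = (\<lambda>x. D x (axis i 1) * gaussian x)"
    using frechet_derivative_at[OF D(2), symmetric] by (simp add: P(2))
  then show ?case using D(1) by blast
qed

lemma schwartz_gaussian: "schwartz gaussian"
  unfolding schwartz_def
proof (intro conjI allI)
  fix "is" :: "'n::finite list"
  obtain P where P: "real_polynomial_function P" "partials is gaussian = (\<lambda>x. P x * gaussian x)"
    using partials_gaussian by blast
  show "partials is gaussian differentiable_on UNIV"
    using polynomial_times_gaussian_has_derivative[OF P(1)] unfolding P(2)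
    by (auto simp: differentiable_on_def differentiable_def)
  fix m
  obtain C k where C: "0 \<le> C" "\<And>x. \<bar>P x\<bar> \<le> C * (1 + norm x) ^ k"
    using real_polynomial_growth[OF P(1)] by blast
  have "norm (norm x ^ m * partials is gaussian x) \<le> C * (fact (m + k) * exp 2)" for x
  proof -
    have g: "0 \<le> gaussian x" by (simp add: gaussian_def)
    have "norm x ^ m * \<bar>P x\<bar> \<le> (1 + norm x) ^ m * (C * (1 + norm x) ^ k)"
      using C by (intro mult_mono power_mono) auto
    from mult_right_mono[OF this g]
    have "norm (norm x ^ m * partials is gaussian x) \<le> C * ((1 + norm x) ^ (m + k) * gaussian x)"
      using g by (simp add: P(2) abs_mult power_add mult_ac)
    also have "\<dots> \<le> C * (fact (m + k) * exp 2)"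
      by (intro mult_left_mono gaussian_times_power_le C)
    finally show ?thesis .
  qed
  then show "bounded (range (\<lambda>x. norm x ^ m * partials is gaussian x))"
    unfolding bounded_iff by blast
qed

section \<open>The normalizing constant\<close>

lemma integral_gaussian_pos: "0 < integral\<^sup>L lborel (gaussian :: real^'n \<Rightarrow> real)"
proof -
  let ?g = "gaussian :: real^'n \<Rightarrow> real"
  have pos: "0 < ?g x" for x by (simp add: gaussian_def)
  have "integral\<^sup>L lborel ?g \<noteq> 0"
  proof
    assume "integral\<^sup>L lborel ?g = 0"
    then have "AE x in lborel. ?g x = 0"
      using integral_nonneg_eq_0_iff_AE[OF integrable_schwartz[OF schwartz_gaussian, where 'n='n]]
        less_imp_le[OF pos]
      by simp
    then have "AE x :: real^'n in lborel. False"
      by eventually_elim (use pos in \<open>auto simp: less_le\<close>)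
    then show False by (simp add: AE_iff_null null_sets_def)
  qed
  moreover have "0 \<le> integral\<^sup>L lborel ?g"
    by (intro Bochner_Integration.integral_nonneg less_imp_le pos)
  ultimately show ?thesis by simp
qed

text \<open>The Fourier transform is continuous and nonzero at the origin. The origin itself would be of no use for
identifying a multiplier \<open>k |\<xi>| powr \<alpha>\<close>, which vanishes there for every \<open>k\<close>.\<close>

lemma fourier_nonzero_off_origin:
  fixes f :: "real^'n \<Rightarrow> real"
  assumes f: "integrable lborel f" and nz: "integral\<^sup>L lborel f \<noteq> 0"
  shows "\<exists>\<xi>. \<xi> \<noteq> 0 \<and> fourier f \<xi> \<noteq> 0"
proof -
  have [measurable]: "f \<in> borel_measurable borel" using f by auto
  define e where "e k = (1 / real (Suc k)) *\<^sub>R (axis undefined 1 :: real^'n)" for k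
  have e0: "e k \<noteq> 0" for k by (simp add: e_def)
  have lim: "e \<longlonglongrightarrow> 0"
    unfolding e_def using tendsto_scaleR[OF LIMSEQ_inverse_real_of_nat tendsto_const[of "axis undefined 1 :: real^'n"]]
    by (simp add: inverse_eq_divide)
  have "(\<lambda>k. fourier f (e k)) \<longlonglongrightarrow> (LINT x|lborel. complex_of_real (f x))"
    unfolding fourier_def
  proof (rule integral_dominated_convergence[where w = "\<lambda>x. norm (f x)"])
    have "(\<lambda>k. cis (- (e k \<bullet> x)) * complex_of_real (f x)) \<longlonglongrightarrow> cis (- (0 \<bullet> x)) * complex_of_real (f x)" for x
      by (intro tendsto_intros lim)
    then show "AE x in lborel. (\<lambda>k. cis (- (e k \<bullet> x)) * complex_of_real (f x)) \<longlonglongrightarrow> complex_of_real (f x)"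
      by simp
    show "AE x in lborel. norm (cis (- (e k \<bullet> x)) * complex_of_real (f x)) \<le> norm (f x)" for k
      by (simp add: norm_mult)
  qed (use f in simp_all)
  moreover have "(LINT x|lborel. complex_of_real (f x)) \<noteq> 0" using nz by simp
  ultimately have "\<forall>\<^sub>F k in sequentially. fourier f (e k) \<noteq> 0"
    by (rule tendsto_imp_eventually_ne)
  then show ?thesis using e0 by (auto simp: eventually_sequentially)
qed

text \<open>By \<open>fourier_pv_integral\<close> and \<open>symbol_eq\<close> the multiplier of \<open>k\<close> times the principal value
is \<open>k c |\<xi>| powr \<alpha>\<close>. Evaluating at a nonzero frequency where the transform of the Gaussian does
not vanish shows that \<open>k c = 1\<close> is also necessary.\<close>

lemma frac_const_eq:
  assumes \<alpha>: "0 < \<alpha>" "\<alpha> < 2"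
  shows "frac_const \<alpha> TYPE('n::finite) = 1 / symbol_const \<alpha> TYPE('n)"
proof -
  let ?c = "symbol_const \<alpha> TYPE('n)"
  have c: "0 < ?c" using symbol_const_pos[OF \<alpha>] .
  show ?thesis
    unfolding frac_const_def
  proof (rule the_equality, intro conjI allI impI)
    show "0 < 1 / ?c" using c by simp
    show "fourier (\<lambda>x. 1 / ?c * pv_integral \<alpha> f x) \<xi> = complex_of_real (norm \<xi> powr \<alpha>) * fourier f \<xi>"
      if "schwartz f" for f and \<xi> :: "real^'n"
      using c unfolding fourier_pv_integral[OF \<alpha> that] by (simp add: symbol_eq)
    fix k assume k: "0 < k \<and> (\<forall>(f :: real^'n \<Rightarrow> real) \<xi>. schwartz f \<longrightarrow>
        fourier (\<lambda>x. k * pv_integral \<alpha> f x) \<xi> = complex_of_real (norm \<xi> powr \<alpha>) * fourier f \<xi>)"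
    obtain \<xi> where \<xi>: "\<xi> \<noteq> 0" "fourier (gaussian :: real^'n \<Rightarrow> real) \<xi> \<noteq> 0"
      using fourier_nonzero_off_origin[OF integrable_schwartz[OF schwartz_gaussian]] integral_gaussian_pos
      by (metis less_irrefl)
    have "complex_of_real (k * symbol \<alpha> \<xi>) * fourier gaussian \<xi> = complex_of_real (norm \<xi> powr \<alpha>) * fourier gaussian \<xi>"
      using k schwartz_gaussian fourier_pv_integral[OF \<alpha> schwartz_gaussian, of k \<xi>] by metis
    then have "k * symbol \<alpha> \<xi> = norm \<xi> powr \<alpha>" using \<xi>(2) by (simp only: mult_cancel_right of_real_eq_iff) simp
    then have "k * ?c = 1" using \<xi>(1) by (simp add: symbol_eq)
    then show "k = 1 / ?c" using c by (simp add: field_simps)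
  qed
qed

section \<open>The lower bound for the jump energy\<close>

text \<open>For small \<open>p\<close> integrability of \<open>f\<close> does not suffice; decay of order \<open>N\<close> with
\<open>N p \<ge> n + 1\<close> does.\<close>

lemma integrable_schwartz_powr:
  fixes f :: "real^'n \<Rightarrow> real"
  assumes f: "schwartz f" and p: "0 < p"
  shows "integrable lborel (\<lambda>x. \<bar>f x\<bar> powr p)"
proof -
  define N where "N = nat \<lceil>(real CARD('n) + 1) / p\<rceil>"
  have "(real CARD('n) + 1) / p \<le> real N" unfolding N_def by (rule of_nat_ceiling)
  then have N: "real (CARD('n) + 1) \<le> real N * p" using p by (simp add: field_simps)
  obtain C where C: "0 \<le> C" "\<And>x. \<bar>f x\<bar> \<le> C * decay N x"
    using schwartz_decay[OF f, of "[]" N] by auto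
  have [measurable]: "f \<in> borel_measurable borel" using f by (rule measurable_schwartz)
  have le: "\<bar>f x\<bar> powr p \<le> C powr p * decay (CARD('n) + 1) x" for x
  proof -
    have "\<bar>f x\<bar> powr p \<le> (C * decay N x) powr p" using C p by (intro powr_mono2) auto
    also have "\<dots> = C powr p * decay N x powr p" using C by (simp add: powr_mult)
    also have "decay N x powr p = (1 + norm x) powr - (real N * p)"
      by (simp add: decay_def powr_divide powr_realpow[symmetric] powr_powr powr_minus_divide)
    also have "\<dots> \<le> (1 + norm x) powr - real (CARD('n) + 1)"
      using N by (intro powr_mono) auto
    also have "\<dots> = decay (CARD('n) + 1) x"
      by (subst powr_minus_divide, subst powr_realpow) (simp_all add: decay_def)
    finally show ?thesis using C by (simp add: mult_left_mono)
  qed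
  show ?thesis
    by (rule Bochner_Integration.integrable_bound[of _ "\<lambda>x. C powr p * decay (CARD('n) + 1) x"])
      (use le in \<open>auto intro!: integrable_mult_right integrable_decay simp: abs_mult\<close>)
qed

lemma measure_superlevel_le:
  fixes f :: "real^'n \<Rightarrow> real"
  assumes p: "0 < p" and int: "integrable lborel (\<lambda>x. \<bar>f x\<bar> powr p)"
    and [measurable]: "f \<in> borel_measurable borel" and t: "0 < t"
  shows "emeasure lborel {h. t \<le> \<bar>f (x + h)\<bar>} \<le> ennreal ((LINT y|lborel. \<bar>f y\<bar> powr p) / t powr p)"
proof -
  let ?u = "\<lambda>h. \<bar>f (x + h)\<bar> powr p"
  have "t \<le> \<bar>f y\<bar> \<longleftrightarrow> t powr p \<le> \<bar>f y\<bar> powr p" for y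
    using t p powr_mono2[of p t "\<bar>f y\<bar>"] powr_less_mono2[of p "\<bar>f y\<bar>" t] by (auto simp: not_le[symmetric])
  then have "{h. t \<le> \<bar>f (x + h)\<bar>} = {h \<in> space lborel. t powr p \<le> ?u h}" by simp
  moreover have "integrable lborel ?u"
    using int by (subst integrable_lborel_invariant[OF distr_lborel_translation, where f = "\<lambda>y. \<bar>f y\<bar> powr p"]) auto
  moreover have "integral\<^sup>L lborel ?u = (LINT y|lborel. \<bar>f y\<bar> powr p)"
    by (subst integral_lborel_invariant[OF distr_lborel_translation, where f = "\<lambda>y. \<bar>f y\<bar> powr p"]) auto
  ultimately show ?thesis
    using integral_Markov_inequality[of lborel ?u "t powr p"] t by simp
qed

text \<open>In a ball of volume \<open>2 M\<close> around the origin at least half of the jumps \<open>h\<close> lead to points where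
\<open>|f|\<close> is less than half of \<open>|f x|\<close>. Each of them contributes at least \<open>(|f x| / 2)\<^sup>2\<close>
times the value of the kernel on the boundary of the ball.\<close>

lemma jump_energy_ge_of_superlevel:
  fixes f :: "real^'n \<Rightarrow> real"
  assumes \<alpha>: "0 < \<alpha>" and [measurable]: "f \<in> borel_measurable borel"
    and int: "integrable lborel (\<lambda>h. (f x - f (x + h))\<^sup>2 * kernel \<alpha> h)"
    and A: "f x \<noteq> 0" and M: "0 < M"
    and E: "emeasure lborel {h. \<bar>f x\<bar> / 2 \<le> \<bar>f (x + h)\<bar>} \<le> ennreal M"
  shows "\<bar>f x\<bar>\<^sup>2 \<le> 8 / unit_ball_vol CARD('n) *
    (2 * M / unit_ball_vol CARD('n)) powr (\<alpha> / CARD('n)) * jump_energy \<alpha> f x"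
proof -
  define n where "n = real CARD('n)"
  define w where "w = unit_ball_vol n"
  \<comment> \<open>The radius of the ball of volume \<open>2 M\<close>.\<close>
  define R where "R = (2 * M / w) powr (1 / n)"
  define K where "K = (\<bar>f x\<bar> / 2)\<^sup>2 * R powr - (n + \<alpha>)"
  have n: "0 < n" by (simp add: n_def)
  have w: "0 < w" using n by (simp add: w_def)
  have R: "0 < R" using M w by (simp add: R_def)
  have Rn: "R ^ CARD('n) = 2 * M / w"
    using M w n by (simp add: R_def powr_power n_def)
  let ?E = "{h. \<bar>f x\<bar> / 2 \<le> \<bar>f (x + h)\<bar>}"
  let ?S = "cball 0 R - ?E"
  have [measurable]: "cball (0::real^'n) R \<in> sets borel" by simp
  have [measurable]: "?E \<in> sets borel" by measurable
  have finS: "emeasure lborel ?S < \<infinity>"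
    by (rule le_less_trans[OF emeasure_mono[of ?S "cball 0 R"]]) (use R in \<open>auto simp: emeasure_cball\<close>)
  have "ennreal (2 * M) = emeasure lborel (cball (0::real^'n) R)"
    using R w Rn by (simp add: emeasure_cball flip: w_def n_def)
  also have "\<dots> \<le> emeasure lborel (?S \<union> ?E)" by (intro emeasure_mono) auto
  also have "\<dots> \<le> emeasure lborel ?S + emeasure lborel ?E" by (intro emeasure_subadditive) auto
  also have "\<dots> \<le> ennreal (measure lborel ?S) + ennreal M"
    using E finS by (intro add_mono) (auto simp: emeasure_eq_ennreal_measure less_top)
  also have "\<dots> = ennreal (measure lborel ?S + M)" using M by (subst ennreal_plus) auto
  finally have mS: "M \<le> measure lborel ?S" using M by (subst (asm) ennreal_le_iff) auto
  have pt: "indicator ?S h * K \<le> (f x - f (x + h))\<^sup>2 * kernel \<alpha> h" for h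
  proof (cases "h \<in> ?S")
    case True
    then have lt: "\<bar>f (x + h)\<bar> < \<bar>f x\<bar> / 2" and hR: "norm h \<le> R" by auto
    \<comment> \<open>The jump \<open>h = 0\<close> is excluded, since it leads to \<open>f x\<close> itself.\<close>
    then have h0: "0 < norm h" using A by auto
    have "(\<bar>f x\<bar> / 2)\<^sup>2 \<le> (f x - f (x + h))\<^sup>2"
      using lt by (intro abs_le_square_iff[THEN iffD1]) linarith
    moreover have "R powr - (n + \<alpha>) \<le> kernel \<alpha> h"
      unfolding kernel_def n_def[symmetric] using h0 hR n \<alpha> by (intro powr_mono2') auto
    ultimately show ?thesis using True unfolding K_def by (simp add: mult_mono)
  qed simp
  have "M * K \<le> measure lborel ?S * K" using mS by (intro mult_right_mono) (simp_all add: K_def)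
  also have "\<dots> = (LINT h|lborel. indicator ?S h * K)" by simp
  also have "\<dots> \<le> jump_energy \<alpha> f x"
    unfolding jump_energy_def
    using finS pt by (intro integral_mono int integrable_mult_left integrable_real_indicator) auto
  finally have MK: "M * K \<le> jump_energy \<alpha> f x" .
  have "R powr - (n + \<alpha>) = (2 * M / w) powr (- 1 - \<alpha> / n)"
    using n by (simp add: R_def powr_powr diff_divide_distrib)
  also have "\<dots> = (2 * M / w) powr - 1 * (2 * M / w) powr - (\<alpha> / n)"
    by (simp only: powr_add[symmetric] diff_conv_add_uminus)
  also have "(2 * M / w) powr - 1 = w / (2 * M)" using M w by (simp add: powr_minus_divide)
  finally have "M * K = w / 8 * \<bar>f x\<bar>\<^sup>2 * (2 * M / w) powr - (\<alpha> / n)"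
    using M by (simp add: K_def power_divide)
  then have "w / 8 * \<bar>f x\<bar>\<^sup>2 = (2 * M / w) powr (\<alpha> / n) * (M * K)"
    using M w by (simp add: powr_minus field_simps)
  also have "\<dots> \<le> (2 * M / w) powr (\<alpha> / n) * jump_energy \<alpha> f x"
    using MK by (intro mult_left_mono) auto
  finally have "w / 8 * \<bar>f x\<bar>\<^sup>2 \<le> (2 * M / w) powr (\<alpha> / n) * jump_energy \<alpha> f x" .
  then show ?thesis using w by (simp add: w_def n_def field_simps)
qed

text \<open>By continuity some ball lies in the superlevel set at height \<open>|f x| / 2\<close>, whose measure the integral controls.\<close>

lemma integral_powr_pos:
  fixes f :: "real^'n \<Rightarrow> real"
  assumes f: "schwartz f" and p: "0 < p" and x: "f x \<noteq> 0"
  shows "0 < (LINT y|lborel. \<bar>f y\<bar> powr p)"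
proof -
  have "continuous_on UNIV (\<lambda>h. f (x + h))"
    by (rule continuous_on_compose2[OF continuous_on_schwartz[OF f]]) (auto intro!: continuous_intros)
  then have "open {h. \<bar>f x\<bar> / 2 < \<bar>f (x + h)\<bar>}"
    by (intro open_Collect_less continuous_on_const continuous_on_rabs)
  moreover have "0 \<in> {h. \<bar>f x\<bar> / 2 < \<bar>f (x + h)\<bar>}" using x by simp
  ultimately obtain e where e: "0 < e" "ball 0 e \<subseteq> {h. \<bar>f x\<bar> / 2 < \<bar>f (x + h)\<bar>}"
    by (meson openE)
  have [measurable]: "f \<in> borel_measurable borel" using f by (rule measurable_schwartz)
  have "0 < emeasure lborel (ball (0::real^'n) e)" using e(1) by (simp add: emeasure_ball)
  also have "\<dots> \<le> emeasure lborel {h. \<bar>f x\<bar> / 2 \<le> \<bar>f (x + h)\<bar>}"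
    using e(2) by (intro emeasure_mono) (auto simp: subset_iff less_imp_le)
  also have "\<dots> \<le> ennreal ((LINT y|lborel. \<bar>f y\<bar> powr p) / (\<bar>f x\<bar> / 2) powr p)"
    using x by (intro measure_superlevel_le p integrable_schwartz_powr f) auto
  finally show ?thesis by (simp add: zero_less_divide_iff)
qed

text \<open>Chebyshev's inequality gives \<open>M = \<integral> |f| powr p / (|f x| / 2) powr p\<close> as a bound for the measure of the
superlevel set. The power \<open>\<alpha> / n\<close> of \<open>M\<close> then produces both the power of the norm and the
additional exponent \<open>\<alpha> p / n\<close> of \<open>|f x|\<close>.\<close>

lemma jump_energy_lower_bound:
  fixes f :: "real^'n \<Rightarrow> real"
  assumes \<alpha>: "0 < \<alpha>" "\<alpha> < 2" and p: "0 < p" and f: "schwartz f"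
  shows "\<bar>f x\<bar> powr (2 + \<alpha> * p / CARD('n)) \<le>
    8 / unit_ball_vol CARD('n) * (2 * 2 powr p / unit_ball_vol CARD('n)) powr (\<alpha> / CARD('n)) *
    (Lp_norm p f powr (\<alpha> * p / CARD('n)) * jump_energy \<alpha> f x)"
proof (cases "f x = 0")
  case True
  have "0 \<le> jump_energy \<alpha> f x"
    unfolding jump_energy_def by (intro Bochner_Integration.integral_nonneg) simp
  then show ?thesis using True by simp
next
  case False
  define n where "n = real CARD('n)"
  define w where "w = unit_ball_vol n"
  define I where "I = (LINT y|lborel. \<bar>f y\<bar> powr p)"
  define A where "A = \<bar>f x\<bar>"
  have n: "0 < n" by (simp add: n_def)
  have w: "0 < w" using n by (simp add: w_def)
  have A: "0 < A" using False by (simp add: A_def)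
  have I: "0 < I" unfolding I_def using f p False by (rule integral_powr_pos)
  have m: "f \<in> borel_measurable borel" using f by (rule measurable_schwartz)
  let ?M = "I / (A / 2) powr p"
  have "emeasure lborel {h. A / 2 \<le> \<bar>f (x + h)\<bar>} \<le> ennreal ?M"
    unfolding I_def using A by (intro measure_superlevel_le p m integrable_schwartz_powr f) simp
  moreover have "0 < ?M" using I A by simp
  ultimately have "A\<^sup>2 \<le> 8 / w * (2 * ?M / w) powr (\<alpha> / n) * jump_energy \<alpha> f x"
    unfolding A_def w_def n_def using False
    by (intro jump_energy_ge_of_superlevel \<alpha> m integrable_jump_energy f)
  also have "2 * ?M / w = (2 * 2 powr p / w) * I * A powr - p"
    using A by (simp add: powr_divide powr_minus_divide mult_ac)
  also have "((2 * 2 powr p / w) * I * A powr - p) powr (\<alpha> / n)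
      = (2 * 2 powr p / w) powr (\<alpha> / n) * I powr (\<alpha> / n) * A powr - (\<alpha> * p / n)"
  proof -
    have "- p * (\<alpha> / n) = - (\<alpha> * p / n)" by simp
    then show ?thesis by (simp only: powr_mult powr_powr)
  qed
  finally have "A\<^sup>2 * A powr (\<alpha> * p / n) \<le> (8 / w * ((2 * 2 powr p / w) powr (\<alpha> / n) * I powr (\<alpha> / n) * A powr - (\<alpha> * p / n))
      * jump_energy \<alpha> f x) * A powr (\<alpha> * p / n)"
    by (intro mult_right_mono) auto
  also have "A powr - (\<alpha> * p / n) = 1 / A powr (\<alpha> * p / n)" by (simp add: powr_minus_divide)
  also have "A\<^sup>2 * A powr (\<alpha> * p / n) = A powr (2 + \<alpha> * p / n)"
    using A by (simp add: powr_add)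
  also have "I powr (\<alpha> / n) = Lp_norm p f powr (\<alpha> * p / n)"
    using p by (simp add: Lp_norm_def I_def powr_powr)
  finally show ?thesis using A unfolding A_def w_def n_def by simp
qed

theorem lemma4p1:
  fixes \<alpha> p :: real
  assumes "0 < \<alpha>" and "\<alpha> < 2" and "0 < p"
  shows "\<exists>C>0. \<forall>f :: real^'n \<Rightarrow> real. schwartz f \<longrightarrow> (\<forall>x.
    \<bar>f x\<bar> powr (2 + \<alpha> * p / real CARD('n)) \<le>
      C * Lp_norm p f powr (\<alpha> * p / real CARD('n)) *
        (2 * f x * frac_laplacian \<alpha> f x - frac_laplacian \<alpha> (\<lambda>y. (f y)\<^sup>2) x))"
proof -
  define C where "C = 8 / unit_ball_vol CARD('n) *
    (2 * 2 powr p / unit_ball_vol CARD('n)) powr (\<alpha> / CARD('n))"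
  define c where "c = symbol_const \<alpha> TYPE('n)"
  have c: "0 < c" unfolding c_def by (rule symbol_const_pos) fact+
  have w: "0 < unit_ball_vol (real CARD('n))" by simp
  have C: "0 < C" unfolding C_def using w by (intro mult_pos_pos divide_pos_pos) (simp_all add: w[THEN less_imp_neq, symmetric])
  have E: "2 * f x * frac_laplacian \<alpha> f x - frac_laplacian \<alpha> (\<lambda>y. (f y)\<^sup>2) x = jump_energy \<alpha> f x / c"
    if "schwartz f" for f :: "real^'n \<Rightarrow> real" and x
  proof -
    have "2 * f x * frac_laplacian \<alpha> f x - frac_laplacian \<alpha> (\<lambda>y. (f y)\<^sup>2) x
        = 1 / c * (2 * f x * pv_integral \<alpha> f x - pv_integral \<alpha> (\<lambda>y. (f y)\<^sup>2) x)"
      unfolding frac_laplacian_def frac_const_eq[OF assms(1,2)] c_def by (simp add: right_diff_distrib)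
    then show ?thesis using carre_du_champ[OF assms(1,2) that] by simp
  qed
  show ?thesis
  proof (intro exI[of _ "C * c"] conjI allI impI)
    show "0 < C * c" using C c by simp
    fix f :: "real^'n \<Rightarrow> real" and x
    assume f: "schwartz f"
    show "\<bar>f x\<bar> powr (2 + \<alpha> * p / real CARD('n)) \<le>
      C * c * Lp_norm p f powr (\<alpha> * p / real CARD('n)) *
        (2 * f x * frac_laplacian \<alpha> f x - frac_laplacian \<alpha> (\<lambda>y. (f y)\<^sup>2) x)"
      unfolding E[OF f] using jump_energy_lower_bound[OF assms f, of x, folded C_def] c
      by (simp add: mult.assoc)
  qed
qed

end
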